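(* The roots of the Ehrhart polynomials $\mathrm{G}(s,P)$ of $3$-dimensional lattice polytopes $P\in\mathcal{P}^3$ are contained in $$[-3,-1]\cup\left\{a+\mathrm{i}\,b : a,b\in\mathbb{R},\ -1\leq a<1,\ a^2+b^2\leq 3\right\},$$ and the bounds on $a$ and on $a^2+b^2$ are tight (i.e., none of the constants $-1$, $1$ and $3$ in the second set can be replaced by a better one). Moreover, for $P\in\mathcal{P}^3(l)$, $l\geq 1$, the upper bound $\sqrt3$ on the norm of the complex (non-real) roots of $\mathrm{G}(s,P)$ is only attained by the roots of the Ehrhart polynomial of the simplex $S_3(1)$; that is, the non-real roots of $\mathrm{G}(s,S_3(1))$ have norm $\sqrt3$, and if $P\in\mathcal{P}^3(l)$ with $l\ge1$ and $\mathrm{G}(s,P)$ has a non-real root of norm $\sqrt3$, then $\mathrm{G}(s,P)=\mathrm{G}(s,S_3(1))$.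
   Context: $\mathcal{P}^3$ is the set of all $3$-dimensional convex lattice polytopes in $\mathbb{R}^3$ (vertices in $\mathbb{Z}^3$), and $\mathcal{P}^3(l)$ is the subset of those having exactly $l$ lattice points of $\mathbb{Z}^3$ in their interior. For $P\in\mathcal{P}^3$ the number $\#(kP\cap\mathbb{Z}^3)$ is, for $k\in\mathbb{N}$, a polynomial $\sum_{i=0}^3 \mathrm{G}_i(P)k^i$ of degree $3$ (the Ehrhart polynomial); $\mathrm{G}(s,P)=\sum_{i=0}^3\mathrm{G}_i(P)s^i$ for $s\in\mathbb{C}$. $S_3(1)=\mathrm{conv}\{e_1,e_2,e_3,-(e_1+e_2+e_3)\}$, where $e_i$ is the $i$-th unit vector. *)

theory Defs
  imports "HOL-Analysis.Analysis" "HOL-Computational_Algebra.Polynomial"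
begin

definition int_lattice :: "(real ^ 3) set" where
  "int_lattice = {x. \<forall>i. x $ i \<in> \<int>}"

definition lattice_polytopes :: "(real ^ 3) set set" where
  "lattice_polytopes =
     {P. polytope P \<and> aff_dim P = 3 \<and> {v. v extreme_point_of P} \<subseteq> int_lattice}"

definition lattice_polytopes_int :: "nat \<Rightarrow> (real ^ 3) set set" where
  "lattice_polytopes_int l =
     {P \<in> lattice_polytopes. card (interior P \<inter> int_lattice) = l}"

text \<open>A polynomial is determined by its values at the natural numbers, so the description below
  has at most one solution; that it has one for lattice polytopes is Ehrhart's theorem. The
  coefficient of index \<open>i\<close> is the number written \<open>G\<^sub>i(P)\<close> in the literature. At \<open>k = 0\<close> the
  dilate is \<open>{0}\<close>, which matches the constant term \<open>1\<close>.\<close>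

definition ehrhart_poly :: "(real ^ 3) set \<Rightarrow> real poly" where
  "ehrhart_poly P =
     (THE p. \<forall>k::nat. poly p (real k) = real (card ((*\<^sub>R) (real k) ` P \<inter> int_lattice)))"

definition ehrhart_fun :: "complex \<Rightarrow> (real ^ 3) set \<Rightarrow> complex" where
  "ehrhart_fun s P = poly (map_poly complex_of_real (ehrhart_poly P)) s"

definition root_region :: "real \<Rightarrow> real \<Rightarrow> real \<Rightarrow> complex set" where
  "root_region \<alpha> \<beta> \<rho> =
     complex_of_real ` {-3..-1} \<union>
     {Complex a b | a b. \<alpha> \<le> a \<and> a < \<beta> \<and> a\<^sup>2 + b\<^sup>2 \<le> \<rho>}"

definition S3_1 :: "(real ^ 3) set" where
  "S3_1 = convex hull
     {axis 1 1, axis 2 1, axis 3 1, - (axis 1 1 + axis 2 1 + axis 3 1)}"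

end

theory Submission
  imports Defs
begin

text \<open>
  Write the number of lattice points of \<open>k P\<close> as
  \<open>(k+3 choose 3) + h1 (k+2 choose 3) + h2 (k+1 choose 3) + h3 (k choose 3)\<close>. The location of the
  roots is a matter of elementary algebra once it is known that such natural numbers exist, that \<open>h3\<close>
  is the number of interior lattice points, that \<open>h3 \<le> h1\<close>, and that Stanley's inequality
  \<open>h1 + 1 \<le> h2 + h3\<close> holds as soon as there is an interior lattice point (\<open>h_star_theorem\<close>).

  For this, a finite set of lattice points with convex hull \<open>P\<close> is lifted to height one in
  \<open>\<real>\<^sup>3 \<times> \<real>\<close>, and the cone over it is dissected by a regular subdivision: for generic heights of the
  generators, the bases on the lower hull are the cells. They cover the cone by the simplex algorithm
  (\<open>lower_bases_cover\<close>) and have disjoint interiors (\<open>lower_bases_disjoint\<close>). A generic vector \<open>q\<close>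
  assigns every point of the cone to exactly one cell, the one that it enters when it is moved a
  little towards \<open>q\<close> (\<open>half_open_partition\<close>), so that no inclusion-exclusion over faces is needed. In
  the half-open cone of a cell, every lattice point is uniquely a point of a half-open box plus a
  nonnegative integral combination of the generators (\<open>half_open_level_bij\<close>). Counting by height gives
  the formula above, with \<open>hj\<close> the number of box points of height \<open>j\<close>. With \<open>- q\<close> in place of \<open>q\<close> the
  half-open cones partition the interior instead, and the reflection of the boxes identifies \<open>h3\<close>
  (\<open>interior_level_one\<close>).

  Stanley's inequality says that there are at most \<open>h2 + 3\<close> lattice points on the boundary. To see
  this, cone the boundary from an interior lattice point \<open>a\<close>, using all lattice points of the boundary,
  and choose \<open>q\<close> close to \<open>a\<close>. Reflecting \<open>q\<close> in \<open>a\<close> interchanges the cells of which one facet through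
  \<open>a\<close> is removed with those of which two are removed. The latter have a box point of height two each,
  and all boundary lattice points but three, those of the one cell of which no facet is removed, inject
  into the former (\<open>star_bound\<close>).

  The Ehrhart polynomial, multiplied by 6, is a cubic \<open>A x\<^sup>3 + B x\<^sup>2 + C x + 6\<close>. If it has the nonreal
  roots \<open>a \<plusminus> i b\<close>, and \<open>v = a\<^sup>2 + b\<^sup>2\<close>, it is the product of \<open>x\<^sup>2 - 2 a x + v\<close> and \<open>A x + 6 / v\<close>. Its values at
  -1, -2 and -2/A then give the bounds for \<open>a\<close> and \<open>v\<close>, and its value at -2/A vanishes for \<open>h3 \<ge> 1\<close> only if
  \<open>h1 = h2 = h3 = 1\<close> (\<open>nonreal_root_bounds\<close>), which is the vector of \<open>S\<^sub>3(1)\<close>. The bounds are tight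
  because of the Reeve tetrahedra, with \<open>h1 = h3 = 0\<close> and \<open>h2 = r - 1\<close>: for \<open>r = 2\<close> there are the roots
  \<open>-1 \<plusminus> i \<surd>2\<close>, and for large \<open>r\<close> there is a real root just below 1.
\<close>

section \<open>Coordinates with respect to a basis\<close>

abbreviation coord :: "'a::real_vector set \<Rightarrow> 'a \<Rightarrow> 'a \<Rightarrow> real" where
  "coord \<equiv> real_vector.representation"

definition basis :: "'a::real_vector set \<Rightarrow> bool" where
  "basis T \<longleftrightarrow> finite T \<and> independent T \<and> span T = UNIV"

lemma basis_finite: "basis T \<Longrightarrow> finite T"
  by (simp add: basis_def)

lemma coord_add: "basis T \<Longrightarrow> coord T (x + y) t = coord T x t + coord T y t"
  by (simp add: basis_def real_vector.representation_add)

lemma coord_diff: "basis T \<Longrightarrow> coord T (x - y) t = coord T x t - coord T y t"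
  by (simp add: basis_def real_vector.representation_diff)

lemma coord_scale: "basis T \<Longrightarrow> coord T (c *\<^sub>R x) t = c * coord T x t"
  by (simp add: basis_def real_vector.representation_scale)

lemma coord_minus: "basis T \<Longrightarrow> coord T (- x) t = - coord T x t"
  using coord_scale[of T "-1" x t] by simp

lemma coord_zero [simp]: "coord T 0 t = 0"
  by (simp add: real_vector.representation_zero)

lemma coord_sum: "basis T \<Longrightarrow> coord T (\<Sum>i\<in>I. f i) t = (\<Sum>i\<in>I. coord T (f i) t)"
  by (simp add: basis_def real_vector.representation_sum)

lemma coord_basis: "basis T \<Longrightarrow> u \<in> T \<Longrightarrow> coord T u t = (if t = u then 1 else 0)"
  by (simp add: basis_def real_vector.representation_basis)

lemma sum_coord: "basis T \<Longrightarrow> (\<Sum>t\<in>T. coord T x t *\<^sub>R t) = x"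
  by (simp add: basis_def real_vector.sum_representation_eq)

lemma coord_combination:
  assumes "basis T" "t \<in> T"
  shows "coord T (\<Sum>u\<in>T. c u *\<^sub>R u) t = c t"
proof -
  have "coord T (\<Sum>u\<in>T. c u *\<^sub>R u) t = (\<Sum>u\<in>T. if t = u then c u else 0)"
    using assms by (auto simp: coord_sum coord_scale coord_basis intro!: sum.cong)
  then show ?thesis using assms by (simp add: basis_finite)
qed

section \<open>Regular subdivisions of a polyhedral cone\<close>

text \<open>The linear function that interpolates the heights \<open>\<omega>\<close> on the basis \<open>T\<close>.\<close>

definition lift_at :: "('a::real_vector \<Rightarrow> real) \<Rightarrow> 'a set \<Rightarrow> 'a \<Rightarrow> real" where
  "lift_at \<omega> T x = (\<Sum>t\<in>T. coord T x t * \<omega> t)"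

lemma lift_at_add: "basis T \<Longrightarrow> lift_at \<omega> T (x + y) = lift_at \<omega> T x + lift_at \<omega> T y"
  by (simp add: lift_at_def coord_add algebra_simps sum.distrib)

lemma lift_at_scale: "basis T \<Longrightarrow> lift_at \<omega> T (c *\<^sub>R x) = c * lift_at \<omega> T x"
  by (simp add: lift_at_def coord_scale algebra_simps sum_distrib_left)

lemma lift_at_sum: "basis T \<Longrightarrow> lift_at \<omega> T (\<Sum>i\<in>I. f i) = (\<Sum>i\<in>I. lift_at \<omega> T (f i))"
  by (simp add: lift_at_def coord_sum sum_distrib_right) (rule sum.swap)

lemma lift_at_vertex: "basis T \<Longrightarrow> t \<in> T \<Longrightarrow> lift_at \<omega> T t = \<omega> t"
  by (simp add: lift_at_def coord_basis basis_finite if_distrib[of "\<lambda>c. c * _"] cong: if_cong)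

definition bases_in :: "'a::real_vector set \<Rightarrow> 'a set set" where
  "bases_in V = {T. T \<subseteq> V \<and> basis T}"

text \<open>Lift every generator \<open>v\<close> to the height \<open>\<omega> v\<close>. A basis spans a lower facet of the lifted cone when
  all other generators lie strictly above the hyperplane through it. Projected back, the lower
  facets are the cells of the regular subdivision that \<open>\<omega>\<close> induces.\<close>

definition lower_bases :: "('a::real_vector \<Rightarrow> real) \<Rightarrow> 'a set \<Rightarrow> 'a set set" where
  "lower_bases \<omega> V = {T \<in> bases_in V. \<forall>v\<in>V - T. lift_at \<omega> T v < \<omega> v}"

definition nonneg_span :: "'a::real_vector set \<Rightarrow> 'a set" where
  "nonneg_span V = {\<Sum>v\<in>V. c v *\<^sub>R v | c. \<forall>v\<in>V. 0 \<le> c v}"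

lemma nonneg_span_basis: "basis T \<Longrightarrow> nonneg_span T = {x. \<forall>t\<in>T. 0 \<le> coord T x t}"
  unfolding nonneg_span_def
  by (auto simp: coord_combination) (metis sum_coord)

lemma nonneg_span_mono:
  assumes "finite W" "V \<subseteq> W"
  shows "nonneg_span V \<subseteq> nonneg_span W"
proof
  fix x assume "x \<in> nonneg_span V"
  then obtain c where c: "x = (\<Sum>v\<in>V. c v *\<^sub>R v)" "\<forall>v\<in>V. 0 \<le> c v"
    by (auto simp: nonneg_span_def)
  have "x = (\<Sum>v\<in>W. (if v \<in> V then c v else 0) *\<^sub>R v)"
    unfolding c(1) using assms by (intro sum.mono_neutral_cong_left) auto
  then show "x \<in> nonneg_span W"
    using c(2) unfolding nonneg_span_def by force
qed

lemma nonneg_span_add: "x \<in> nonneg_span V \<Longrightarrow> y \<in> nonneg_span V \<Longrightarrow> x + y \<in> nonneg_span V"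
  unfolding nonneg_span_def
  apply clarsimp
  subgoal for c d
    by (rule exI[of _ "\<lambda>v. c v + d v"]) (simp add: algebra_simps sum.distrib)
  done

lemma nonneg_span_scale: "x \<in> nonneg_span V \<Longrightarrow> 0 \<le> r \<Longrightarrow> r *\<^sub>R x \<in> nonneg_span V"
  unfolding nonneg_span_def
  apply clarsimp
  subgoal for c
    by (rule exI[of _ "\<lambda>v. r * c v"]) (simp add: scaleR_sum_right)
  done

lemma zero_in_nonneg_span: "0 \<in> nonneg_span V"
  unfolding nonneg_span_def by (auto intro!: exI[of _ "\<lambda>_. 0"])

lemma nonneg_span_base: "finite V \<Longrightarrow> v \<in> V \<Longrightarrow> v \<in> nonneg_span V"
  unfolding nonneg_span_def
  by (auto intro!: exI[of _ "\<lambda>u. if u = v then 1 else 0"] simp: if_distrib[of "\<lambda>c. c *\<^sub>R _"] cong: if_cong)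

text \<open>Subtract a multiple of a linear relation from the combination. The multiple at which the first
  coefficient vanishes is the least ratio over the positive entries of the relation.\<close>

lemma reduce_dependent_combination:
  fixes S :: "'a::real_vector set"
  assumes S: "finite S" "dependent S" and c: "\<forall>v\<in>S. 0 < c v" 
  shows "\<exists>v0\<in>S. \<exists>d. (\<forall>v\<in>S. 0 \<le> d v) \<and> d v0 = 0 \<and> (\<Sum>v\<in>S. d v *\<^sub>R v) = (\<Sum>v\<in>S. c v *\<^sub>R v)"
proof -
  from S obtain u0 where u0: "\<exists>v\<in>S. u0 v \<noteq> 0" "(\<Sum>v\<in>S. u0 v *\<^sub>R v) = 0"
    by (auto simp: real_vector.dependent_finite)
  \<comment> \<open>Some entry of the relation or of its negative is positive.\<close>
  obtain u where u: "\<exists>v\<in>S. u v > 0" "(\<Sum>v\<in>S. u v *\<^sub>R v) = 0"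
  proof (cases "\<exists>v\<in>S. u0 v > 0")
    case True then show ?thesis using u0 that by blast
  next
    case False then show ?thesis using u0 that[of "\<lambda>v. - u0 v"]
      by (auto simp: sum_negf not_less) (meson neg_0_less_iff_less order_le_less)
  qed
  define S' where "S' = {v\<in>S. u v > 0}"
  define e where "e = Min ((\<lambda>v. c v / u v) ` S')"
  have fin: "finite S'" "S' \<noteq> {}" using S u by (auto simp: S'_def)
  have "e \<in> (\<lambda>v. c v / u v) ` S'" unfolding e_def using fin by (intro Min_in) auto
  then obtain v0 where v0: "v0 \<in> S'" "e = c v0 / u v0" by auto
  have le: "e \<le> c v / u v" if "v \<in> S'" for v
    unfolding e_def using fin that by (intro Min_le) auto
  have e: "e > 0" using v0 c by (auto simp: S'_def)
  have "0 \<le> c v - e * u v" if "v \<in> S" for v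
  proof (cases "u v > 0")
    case True with that le[of v] show ?thesis by (simp add: S'_def field_simps)
  next
    case False then show ?thesis using e c that by (smt (verit) mult_nonneg_nonpos)
  qed
  moreover have "c v0 - e * u v0 = 0" using v0 by (simp add: S'_def)
  moreover have "(\<Sum>v\<in>S. (c v - e * u v) *\<^sub>R v) = (\<Sum>v\<in>S. c v *\<^sub>R v) - e *\<^sub>R (\<Sum>v\<in>S. u v *\<^sub>R v)"
    by (simp add: algebra_simps sum_subtractf scaleR_sum_right)
  ultimately show ?thesis using v0 u(2)
    by (intro bexI[of _ v0] exI[of _ "\<lambda>v. c v - e * u v"]) (auto simp: S'_def)
qed

text \<open>Caratheodory's theorem for cones: drop generators along linear relations until none is left.\<close>

lemma conic_caratheodory:
  fixes V :: "'a::real_vector set"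
  assumes "finite V" "x \<in> nonneg_span V"
  shows "\<exists>S\<subseteq>V. independent S \<and> x \<in> nonneg_span S"
  using assms
proof (induction "card V" arbitrary: V rule: less_induct)
  case less
  show ?case
  proof (cases "independent V")
    case True then show ?thesis using less by blast
  next
    case False
    obtain c where c: "x = (\<Sum>v\<in>V. c v *\<^sub>R v)" "\<forall>v\<in>V. 0 \<le> c v"
      using less.prems by (auto simp: nonneg_span_def)
    have "\<exists>v0\<in>V. \<exists>d. (\<forall>v\<in>V. 0 \<le> d v) \<and> d v0 = 0 \<and> (\<Sum>v\<in>V. d v *\<^sub>R v) = x"
    proof (cases "\<forall>v\<in>V. 0 < c v")
      case True
      then show ?thesis using reduce_dependent_combination[of V c] False less.prems(1) c by auto
    next
      case False
      then obtain v0 where "v0 \<in> V" "c v0 = 0" using c(2) by force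
      then show ?thesis using c by auto
    qed
    then obtain v0 d where d: "v0 \<in> V" "\<forall>v\<in>V. 0 \<le> d v" "d v0 = 0" "(\<Sum>v\<in>V. d v *\<^sub>R v) = x"
      by blast
    have "x = (\<Sum>v\<in>V - {v0}. d v *\<^sub>R v)"
      using d less.prems(1) by (simp add: sum.remove)
    then have "x \<in> nonneg_span (V - {v0})"
      unfolding nonneg_span_def using d(2) by auto
    moreover have "card (V - {v0}) < card V" using d less.prems by (meson card_Diff1_less)
    ultimately have "\<exists>S\<subseteq>V - {v0}. independent S \<and> x \<in> nonneg_span S"
      using less.hyps less.prems(1) by blast
    then show ?thesis by blast
  qed
qed

text \<open>A starting point for the simplex algorithm: the independent set from Caratheodory's theorem is
  completed to a basis by generators that get coefficient zero.\<close>

lemma cone_covered_by_bases: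
  fixes V :: "'a::euclidean_space set"
  assumes "finite V" "span V = UNIV" "x \<in> nonneg_span V"
  shows "\<exists>T\<in>bases_in V. x \<in> nonneg_span T"
proof -
  obtain S where S: "S \<subseteq> V" "independent S" "x \<in> nonneg_span S"
    using conic_caratheodory assms by blast
  obtain T where T: "S \<subseteq> T" "T \<subseteq> V" "independent T" "V \<subseteq> span T"
    using real_vector.maximal_independent_subset_extend[OF S(1,2)] by blast
  have "span T = UNIV" using T(4) assms(2)
    by (metis span_mono span_span top.extremum_uniqueI)
  moreover have "finite T" using T(2) assms(1) finite_subset by blast
  ultimately show ?thesis using T S nonneg_span_mono[of T S]
    by (auto simp: bases_in_def basis_def)
qed

text \<open>For such heights no other generator lies on the hyperplane of a lifted basis, which makes every
  cell of the regular subdivision simplicial.\<close>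

definition generic_lift :: "('a::real_vector \<Rightarrow> real) \<Rightarrow> 'a set \<Rightarrow> bool" where
  "generic_lift \<omega> V \<longleftrightarrow> (\<forall>T\<in>bases_in V. \<forall>v\<in>V - T. lift_at \<omega> T v \<noteq> \<omega> v)"

definition generic_point :: "'a::real_vector \<Rightarrow> 'a set \<Rightarrow> bool" where
  "generic_point x V \<longleftrightarrow> (\<forall>T\<in>bases_in V. \<forall>t\<in>T. coord T x t \<noteq> 0)"

lemma basis_exchange:
  assumes T: "basis T" "t0 \<in> T" "coord T v t0 \<noteq> 0"
  shows "basis (insert v (T - {t0}))"
proof -
  have ind: "independent T" and fin: "finite T" using T by (auto simp: basis_def)
  have nv: "v \<notin> span (T - {t0})"
  proof
    assume v: "v \<in> span (T - {t0})"
    have "coord T v = coord (T - {t0}) v"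
      by (rule real_vector.representation_extend[OF ind v]) auto
    then show False using T(3) real_vector.representation_ne_zero[of "T - {t0}" v t0] by auto
  qed
  have "independent (T - {t0})" using ind real_vector.independent_mono by blast
  then have i: "independent (insert v (T - {t0}))"
    using nv by (rule real_vector.independent_insertI[rotated])
  let ?S = "insert v (T - {t0})"
  have "v = coord T v t0 *\<^sub>R t0 + (\<Sum>t\<in>T - {t0}. coord T v t *\<^sub>R t)"
    using sum_coord[OF T(1), of v] T(2) fin by (simp add: sum.remove)
  then have "coord T v t0 *\<^sub>R t0 = v - (\<Sum>t\<in>T - {t0}. coord T v t *\<^sub>R t)"
    by (metis add_diff_cancel_right')
  also have "\<dots> \<in> span ?S"
    by (intro span_diff span_base span_sum span_scale) auto
  finally have "(1 / coord T v t0) *\<^sub>R (coord T v t0 *\<^sub>R t0) \<in> span ?S"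
    by (rule span_scale)
  then have "t0 \<in> span ?S" using T(3) by simp
  then have "T \<subseteq> span ?S" by (auto intro: span_base)
  then have "span ?S = UNIV"
    using T(1) by (metis basis_def span_mono span_span top.extremum_uniqueI)
  then show ?thesis using i fin by (simp add: basis_def)
qed

text \<open>A pivot of the simplex algorithm. The generator \<open>v\<close> lies below the lifted hyperplane of \<open>T\<close>, so it
  pays to let it enter the basis; the ratio test chooses the vector \<open>t0\<close> that leaves, so that \<open>x\<close>
  stays in the cone, and the height over \<open>x\<close> drops.\<close>

lemma pivot_step:
  assumes V: "T \<in> bases_in V" "v \<in> V - T" and x: "\<forall>t\<in>T. 0 < coord T x t"
    and lt: "\<omega> v < lift_at \<omega> T v" and vpos: "\<exists>t\<in>T. 0 < coord T v t"
  shows "\<exists>T'\<in>bases_in V. x \<in> nonneg_span T' \<and> lift_at \<omega> T' x < lift_at \<omega> T x"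
proof -
  have T: "basis T" "T \<subseteq> V" and fin: "finite T" using V by (auto simp: bases_in_def basis_def)
  define S where "S = {t\<in>T. 0 < coord T v t}"
  define e where "e = Min ((\<lambda>t. coord T x t / coord T v t) ` S)"
  have S: "finite S" "S \<noteq> {}" using fin vpos by (auto simp: S_def)
  have "e \<in> (\<lambda>t. coord T x t / coord T v t) ` S" unfolding e_def using S by (intro Min_in) auto
  then obtain t0 where t0: "t0 \<in> S" "e = coord T x t0 / coord T v t0" by auto
  have le: "e \<le> coord T x t / coord T v t" if "t \<in> S" for t
    unfolding e_def using S that by (intro Min_le) auto
  have e: "e > 0" using t0 x by (auto simp: S_def)
  have nn: "0 \<le> coord T x t - e * coord T v t" if "t \<in> T" for t
  proof (cases "coord T v t > 0")
    case True with that le[of t] show ?thesis by (simp add: S_def field_simps)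
  next
    case False then show ?thesis using e x that by (smt (verit) mult_nonneg_nonpos)
  qed
  have z: "coord T x t0 - e * coord T v t0 = 0" using t0 by (simp add: S_def)
  let ?T' = "insert v (T - {t0})"
  have b': "basis ?T'" using basis_exchange[OF T(1), of t0 v] t0 by (auto simp: S_def)
  have vT: "v \<notin> T" using V by auto
  have "x = (x - e *\<^sub>R v) + e *\<^sub>R v" by simp
  also have "x - e *\<^sub>R v = (\<Sum>t\<in>T. (coord T x t - e * coord T v t) *\<^sub>R t)"
    using sum_coord[OF T(1), of "x - e *\<^sub>R v"] by (simp add: coord_diff coord_scale T(1))
  also have "\<dots> = (\<Sum>t\<in>T - {t0}. (coord T x t - e * coord T v t) *\<^sub>R t)"
    using fin z by (intro sum.mono_neutral_right) auto
  finally have xeq: "x = (\<Sum>t\<in>T - {t0}. (coord T x t - e * coord T v t) *\<^sub>R t) + e *\<^sub>R v" .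
  have xeq': "x = (\<Sum>t\<in>?T'. (if t = v then e else coord T x t - e * coord T v t) *\<^sub>R t)"
  proof -
    have "(\<Sum>t\<in>T - {t0}. (if t = v then e else coord T x t - e * coord T v t) *\<^sub>R t)
        = (\<Sum>t\<in>T - {t0}. (coord T x t - e * coord T v t) *\<^sub>R t)"
      by (rule sum.cong) (use vT in auto)
    then show ?thesis using fin vT by (subst xeq) simp
  qed
  have "x \<in> nonneg_span ?T'"
    unfolding nonneg_span_def mem_Collect_eq using e nn xeq'
    by (intro exI[of _ "\<lambda>t. if t = v then e else coord T x t - e * coord T v t"] conjI) auto
  moreover have "lift_at \<omega> ?T' x = (\<Sum>t\<in>T - {t0}. (coord T x t - e * coord T v t) * \<omega> t) + e * \<omega> v"
    using arg_cong[OF xeq, of "lift_at \<omega> ?T'"]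
    by (simp add: lift_at_add[OF b'] lift_at_sum[OF b'] lift_at_scale[OF b'] lift_at_vertex[OF b'])
  moreover have "(\<Sum>t\<in>T - {t0}. (coord T x t - e * coord T v t) * \<omega> t) = 
     (\<Sum>t\<in>T. (coord T x t - e * coord T v t) * \<omega> t)"
    using fin z by (intro sum.mono_neutral_left) auto
  moreover have "\<dots> = lift_at \<omega> T x - e * lift_at \<omega> T v"
    by (simp add: lift_at_def algebra_simps sum_subtractf sum_distrib_left)
  moreover have "e * \<omega> v < e * lift_at \<omega> T v" using e lt by simp
  ultimately show ?thesis using b' T V by (intro bexI[of _ ?T']) (auto simp: bases_in_def)
qed

text \<open>Among the finitely many bases whose cone contains \<open>x\<close>, take one that is lowest over \<open>x\<close>. No pivot
  can improve it, so no generator lies below its hyperplane, and none lies on it by genericity. Positivity of \<open>\<eta>\<close> gives every entering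
  generator a positive coordinate, without which the ratio test would have no candidate.\<close>

lemma lower_bases_cover:
  fixes V :: "'a::euclidean_space set"
  assumes V: "finite V" "span V = UNIV" and \<eta>: "linear \<eta>" "\<forall>v\<in>V. (0::real) < \<eta> v"
    and \<omega>: "generic_lift \<omega> V" and x: "x \<in> nonneg_span V" "generic_point x V"
  shows "\<exists>T\<in>lower_bases \<omega> V. \<forall>t\<in>T. 0 < coord T x t"
proof -
  define C where "C = {T\<in>bases_in V. x \<in> nonneg_span T}"
  have "finite C" unfolding C_def bases_in_def
    by (rule finite_subset[of _ "Pow V"]) (use V in auto)
  moreover have "C \<noteq> {}" using cone_covered_by_bases[OF V x(1)] by (auto simp: C_def)
  ultimately obtain T where T: "T \<in> C" "\<And>T'. T' \<in> C \<Longrightarrow> lift_at \<omega> T x \<le> lift_at \<omega> T' x"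
    using arg_min_if_finite(1)[of C "\<lambda>T. lift_at \<omega> T x"] arg_min_least[of C _ "\<lambda>T. lift_at \<omega> T x"]
    by blast
  have b: "T \<in> bases_in V" "basis T" using T by (auto simp: C_def bases_in_def)
  have pos: "\<forall>t\<in>T. 0 < coord T x t"
    using T(1) x(2) nonneg_span_basis[OF b(2)]
    by (auto simp: C_def generic_point_def order_less_le)
  have "lift_at \<omega> T v < \<omega> v" if v: "v \<in> V - T" for v
  proof (rule ccontr)
    assume "\<not> ?thesis"
    then have "\<omega> v < lift_at \<omega> T v" using \<omega> b v by (force simp: generic_lift_def)
    moreover have "\<exists>t\<in>T. 0 < coord T v t"
    proof (rule ccontr)
      assume *: "\<not> ?thesis"
      have "\<eta> v = (\<Sum>t\<in>T. coord T v t * \<eta> t)"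
        by (subst (1) sum_coord[OF b(2), of v, symmetric])
          (simp add: linear_sum[OF \<eta>(1)] linear_scale[OF \<eta>(1)])
      also have "\<dots> \<le> 0" using * \<eta>(2) b
        by (intro sum_nonpos) (auto simp: bases_in_def not_less intro!: mult_nonpos_nonneg less_imp_le[of 0 "\<eta> _"])
      finally show False using v \<eta>(2) by force
    qed
    ultimately obtain T' where "T'\<in>bases_in V" "x \<in> nonneg_span T'" "lift_at \<omega> T' x < lift_at \<omega> T x"
      using pivot_step[OF b(1) v pos] by blast
    then show False using T(2)[of T'] by (auto simp: C_def)
  qed
  then show ?thesis using b pos by (auto simp: lower_bases_def)
qed

text \<open>The interpolation over a lower basis \<open>S\<close> is a lower bound for all heights, and a strict one off
  \<open>S\<close>. At a point of the open cone over \<open>T\<close>, which uses all of \<open>T\<close>, it is therefore strictly below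
  the interpolation over \<open>T\<close> unless \<open>T \<subseteq> S\<close>. At a common point this cannot hold in both directions.\<close>

lemma lower_bases_disjoint:
  assumes T: "T \<in> lower_bases \<omega> V" and S: "S \<in> lower_bases \<omega> V"
    and xT: "\<forall>t\<in>T. 0 < coord T x t" and xS: "\<forall>t\<in>S. 0 < coord S x t"
  shows "T = S"
proof -
  have gen: "lift_at \<omega> S x < lift_at \<omega> T x"
    if T: "T \<in> lower_bases \<omega> V" and S: "S \<in> lower_bases \<omega> V"
      and xT: "\<forall>t\<in>T. 0 < coord T x t" and ne: "\<not> T \<subseteq> S" for T S
  proof -
    have b: "basis T" "basis S" "T \<subseteq> V" using T S by (auto simp: lower_bases_def bases_in_def)
    have le: "lift_at \<omega> S t \<le> \<omega> t \<and> (t \<notin> S \<longrightarrow> lift_at \<omega> S t < \<omega> t)" if "t \<in> T" for t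
      using S that b lift_at_vertex[OF b(2), of t \<omega>]
      by (cases "t \<in> S") (force simp: lower_bases_def)+
    have "lift_at \<omega> S x = (\<Sum>t\<in>T. coord T x t * lift_at \<omega> S t)"
      by (subst (1) sum_coord[OF b(1), of x, symmetric]) (simp add: lift_at_sum b lift_at_scale)
    also have "\<dots> < (\<Sum>t\<in>T. coord T x t * \<omega> t)"
      using ne le xT by (intro sum_strict_mono_ex1) (auto simp: basis_finite b)
    finally show ?thesis by (simp add: lift_at_def)
  qed
  have "T \<subseteq> S \<or> S \<subseteq> T" using gen[OF T S xT] gen[OF S T xS] by force
  moreover have "T = S" if "T \<subseteq> S" "basis T" "basis S" for T S :: "'a set"
    using that by (metis basis_def real_vector.spanning_subset_independent UNIV_I subsetI)
  ultimately show ?thesis using T S by (metis (no_types, lifting) lower_bases_def bases_in_def mem_Collect_eq)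
qed

section \<open>Half-open cells and their lattice points\<close>

lemma card_basis: "basis T \<Longrightarrow> card T = DIM('a)" for T :: "'a::euclidean_space set"
  using dim_span_eq_card_independent[of T] unfolding basis_def by auto

text \<open>The points from which a small step in direction \<open>q\<close> leads into the open cone over \<open>T\<close>: the closed
  cone without the facets on whose far side \<open>q\<close> lies.\<close>

definition half_open :: "'a::real_vector \<Rightarrow> 'a set \<Rightarrow> 'a set" where
  "half_open q T = {x. \<forall>t\<in>T. 0 < coord T x t \<or> coord T x t = 0 \<and> 0 < coord T q t}"

text \<open>Representatives, inside \<open>half_open q T\<close>, of \<open>L\<close> modulo the lattice generated by \<open>T\<close>. A coordinate
  ranges over \<open>(0, 1]\<close> instead of \<open>[0, 1)\<close> exactly when the corresponding facet is removed.\<close>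

definition half_open_box :: "'a::real_vector set \<Rightarrow> 'a \<Rightarrow> 'a set \<Rightarrow> 'a set" where
  "half_open_box L q T = {p \<in> L. \<forall>t\<in>T. if 0 < coord T q t then 0 \<le> coord T p t \<and> coord T p t < 1
                                          else 0 < coord T p t \<and> coord T p t \<le> 1}"

lemma eventually_sign_affine:
  fixes \<alpha> \<beta> :: real
  assumes "\<beta> \<noteq> 0"
  shows "\<forall>\<^sub>F e in at_right 0. \<alpha> + e * \<beta> \<noteq> 0 \<and> (0 < \<alpha> + e * \<beta> \<longleftrightarrow> 0 < \<alpha> \<or> \<alpha> = 0 \<and> 0 < \<beta>)"
proof (cases "\<alpha> = 0")
  case True
  show ?thesis
    by (rule eventually_mono[OF eventually_at_right_less]) (use True assms in \<open>auto simp: zero_less_mult_iff\<close>)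
next
  case False
  have "0 < \<bar>\<alpha>\<bar> / \<bar>\<beta>\<bar>" using False assms by simp
  then have "\<forall>\<^sub>F e in at_right 0. e \<in> {0<..<\<bar>\<alpha>\<bar> / \<bar>\<beta>\<bar>}"
    by (rule eventually_at_right_real)
  then show ?thesis
  proof eventually_elim
    case (elim e)
    then have "\<bar>e * \<beta>\<bar> < \<bar>\<alpha>\<bar>" using assms by (simp add: abs_mult field_simps)
    then show ?case using False by auto
  qed
qed

lemma eventually_half_open:
  assumes T: "basis T" and q: "\<forall>t\<in>T. coord T q t \<noteq> 0"
  shows "\<forall>\<^sub>F e in at_right 0. (\<forall>t\<in>T. coord T (x + e *\<^sub>R q) t \<noteq> 0) \<and>
            ((\<forall>t\<in>T. 0 < coord T (x + e *\<^sub>R q) t) \<longleftrightarrow> x \<in> half_open q T)"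
proof -
  have "\<forall>\<^sub>F e in at_right 0. \<forall>t\<in>T. coord T (x + e *\<^sub>R q) t \<noteq> 0 \<and> (0 < coord T (x + e *\<^sub>R q) t \<longleftrightarrow>
     0 < coord T x t \<or> coord T x t = 0 \<and> 0 < coord T q t)"
    using eventually_sign_affine q
    by (subst eventually_ball_finite_distrib) (auto simp: basis_finite T coord_add coord_scale)
  then show ?thesis by (rule eventually_mono) (auto simp: half_open_def)
qed

lemma eventually_at_right_0_ex:
  "(\<forall>\<^sub>F e in at_right (0::real). P e) \<Longrightarrow> \<exists>e>0. P e"
  by (metis (mono_tags, lifting) eventually_at_right_field dense)

lemma half_open_nonneg: "x \<in> half_open q T \<Longrightarrow> t \<in> T \<Longrightarrow> 0 \<le> coord T x t"
  by (force simp: half_open_def)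

text \<open>The homogenised situation: generators of height one in a discrete group whose elements have
  integral height. Lattice points of height \<open>k\<close> are those of the \<open>k\<close>-th dilate.\<close>

locale lattice_cone =
  fixes V L :: "'a::euclidean_space set" and \<eta> :: "'a \<Rightarrow> real" and \<omega> :: "'a \<Rightarrow> real"
  assumes finite_V: "finite V" and span_V: "span V = UNIV"
    and linear_\<eta>: "linear \<eta>" and \<eta>_V: "v \<in> V \<Longrightarrow> \<eta> v = 1"
    and V_L: "V \<subseteq> L" and L_diff: "x \<in> L \<Longrightarrow> y \<in> L \<Longrightarrow> x - y \<in> L"
    and L_discrete: "bounded S \<Longrightarrow> finite (L \<inter> S)"
    and \<eta>_L: "x \<in> L \<Longrightarrow> \<eta> x \<in> \<int>"
    and generic: "generic_lift \<omega> V"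
begin

abbreviation "cells \<equiv> lower_bases \<omega> V"

lemma cell_in_bases: "T \<in> cells \<Longrightarrow> T \<in> bases_in V" by (simp add: lower_bases_def)
lemma cell_basis: "T \<in> cells \<Longrightarrow> basis T" by (simp add: lower_bases_def bases_in_def)
lemma cell_subset: "T \<in> cells \<Longrightarrow> T \<subseteq> V" by (simp add: lower_bases_def bases_in_def)
lemma finite_bases: "finite (bases_in V)"
  unfolding bases_in_def by (rule finite_subset[of _ "Pow V"]) (use finite_V in auto)
lemma finite_cells: "finite cells"
  by (rule finite_subset[OF _ finite_bases]) (auto simp: lower_bases_def)

lemma half_open_sub_cone: "T \<in> cells \<Longrightarrow> half_open q T \<subseteq> nonneg_span V"
  using nonneg_span_mono[OF finite_V cell_subset, of T] nonneg_span_basis[OF cell_basis, of T] half_open_nonneg[of _ q T]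
  by blast

text \<open>For small \<open>e\<close> the point \<open>x + e q\<close> is generic and all signs of its coordinates are those that
  \<open>half_open\<close> predicts. So the cell that contains \<open>x\<close> in its half-open cone is the one that contains
  \<open>x + e q\<close> in its interior.\<close>

lemma half_open_partition:
  assumes q: "generic_point q V"
    and x: "\<forall>\<^sub>F e in at_right 0. x + e *\<^sub>R q \<in> nonneg_span V"
  shows "\<exists>!T. T \<in> cells \<and> x \<in> half_open q T"
proof -
  have "\<forall>\<^sub>F e in at_right 0. \<forall>T\<in>bases_in V. (\<forall>t\<in>T. coord T (x + e *\<^sub>R q) t \<noteq> 0) \<and>
            ((\<forall>t\<in>T. 0 < coord T (x + e *\<^sub>R q) t) \<longleftrightarrow> x \<in> half_open q T)"
    using q by (subst eventually_ball_finite_distrib[OF finite_bases])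
      (auto simp: bases_in_def generic_point_def intro!: eventually_half_open)
  then obtain e where e: "\<forall>T\<in>bases_in V. (\<forall>t\<in>T. coord T (x + e *\<^sub>R q) t \<noteq> 0) \<and>
            ((\<forall>t\<in>T. 0 < coord T (x + e *\<^sub>R q) t) \<longleftrightarrow> x \<in> half_open q T)"
    "x + e *\<^sub>R q \<in> nonneg_span V"
    using eventually_at_right_0_ex[OF eventually_conj[OF _ x]] by blast
  then have "generic_point (x + e *\<^sub>R q) V" by (simp add: generic_point_def)
  then obtain T where T: "T \<in> cells" "\<forall>t\<in>T. 0 < coord T (x + e *\<^sub>R q) t"
    using lower_bases_cover[OF finite_V span_V linear_\<eta> _ generic e(2)] \<eta>_V by auto
  show ?thesis
  proof (rule ex1I[of _ T])
    show "T \<in> cells \<and> x \<in> half_open q T" using T e(1) cell_in_bases by blast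
  next
    fix S assume "S \<in> cells \<and> x \<in> half_open q S"
    then have "\<forall>t\<in>S. 0 < coord S (x + e *\<^sub>R q) t" "S \<in> cells" using e(1) cell_in_bases by blast+
    then show "S = T" using lower_bases_disjoint T by blast
  qed
qed

lemma half_open_push:
  assumes q: "generic_point q V" and T: "T \<in> cells" and x: "x \<in> half_open q T"
  shows "\<forall>\<^sub>F e in at_right 0. x + e *\<^sub>R q \<in> nonneg_span V"
proof -
  have "\<forall>t\<in>T. coord T q t \<noteq> 0" using q cell_in_bases[OF T] by (simp add: generic_point_def)
  from eventually_half_open[OF cell_basis[OF T] this, of x] show ?thesis
  proof (rule eventually_mono)
    fix e assume "(\<forall>t\<in>T. coord T (x + e *\<^sub>R q) t \<noteq> 0) \<and>
            ((\<forall>t\<in>T. 0 < coord T (x + e *\<^sub>R q) t) \<longleftrightarrow> x \<in> half_open q T)"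
    then have "x + e *\<^sub>R q \<in> nonneg_span T" 
      using x nonneg_span_basis[OF cell_basis[OF T]] by (auto intro: less_imp_le)
    then show "x + e *\<^sub>R q \<in> nonneg_span V" using nonneg_span_mono[OF finite_V cell_subset[OF T]] by blast
  qed
qed

lemma zero_L: "0 \<in> L"
proof -
  have "V \<noteq> {}" using span_V by auto
  then show ?thesis using V_L L_diff by fastforce
qed

lemma L_add: "x \<in> L \<Longrightarrow> y \<in> L \<Longrightarrow> x + y \<in> L"
  using L_diff[of x "0 - y"] L_diff[of 0 y] zero_L by simp

lemma L_nat_scale: "x \<in> L \<Longrightarrow> real n *\<^sub>R x \<in> L"
  by (induction n) (auto simp: zero_L L_add algebra_simps)

lemma L_sum: "(\<And>i. i \<in> I \<Longrightarrow> f i \<in> L) \<Longrightarrow> (\<Sum>i\<in>I. f i) \<in> L"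
  by (induction I rule: infinite_finite_induct) (auto simp: zero_L L_add)

lemma \<eta>_coord: "T \<in> bases_in V \<Longrightarrow> \<eta> x = (\<Sum>t\<in>T. coord T x t)"
  apply (subst sum_coord[of T x, symmetric])
   apply (simp add: bases_in_def)
  apply (auto simp: linear_sum[OF linear_\<eta>] linear_scale[OF linear_\<eta>] bases_in_def \<eta>_V subset_iff coord_combination
     intro!: sum.cong)
  done


lemma finite_coord_bounded:
  assumes T: "basis T" shows "finite {p\<in>L. \<forall>t\<in>T. \<bar>coord T p t\<bar> \<le> 1}"
proof -
  have "norm p \<le> (\<Sum>t\<in>T. norm t)" if "\<forall>t\<in>T. \<bar>coord T p t\<bar> \<le> 1" for p
  proof -
    have "norm p = norm (\<Sum>t\<in>T. coord T p t *\<^sub>R t)" by (simp add: sum_coord T)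
    also have "\<dots> \<le> (\<Sum>t\<in>T. norm (coord T p t *\<^sub>R t))" by (rule norm_sum)
    also have "\<dots> \<le> (\<Sum>t\<in>T. norm t)" using that by (intro sum_mono) (auto intro: mult_left_le_one_le)
    finally show ?thesis .
  qed
  then have "bounded {p. \<forall>t\<in>T. \<bar>coord T p t\<bar> \<le> 1}" by (auto intro!: boundedI)
  from L_discrete[OF this] show ?thesis by (simp add: Collect_conj_eq)
qed

lemma finite_box: "basis T \<Longrightarrow> finite (half_open_box L q T)"
  by (rule finite_subset[OF _ finite_coord_bounded[of T]]) (force simp: half_open_box_def split: if_splits)+

abbreviation multi_comb :: "'a multiset \<Rightarrow> 'a set \<Rightarrow> 'a" where
  "multi_comb M T \<equiv> \<Sum>t\<in>T. real (count M t) *\<^sub>R t"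

text \<open>Division with remainder in every coordinate: a lattice point of the half-open cone is a box point
  plus generators, and the multiset records how often each generator is used.\<close>

lemma half_open_level_bij:
  assumes T: "T \<in> bases_in V" and q: "\<forall>t\<in>T. coord T q t \<noteq> 0"
  shows "bij_betw (\<lambda>(p, M). p + multi_comb M T)
           (SIGMA p:{p\<in>half_open_box L q T. \<eta> p \<le> real k}. multisets_of_size T (k - nat \<lfloor>\<eta> p\<rfloor>))
           {x \<in> L \<inter> half_open q T. \<eta> x = real k}"
    (is "bij_betw ?f ?A ?B")
proof -
  have b: "basis T" "T \<subseteq> L" using T V_L by (auto simp: bases_in_def)
  have fin: "finite T" using b by (simp add: basis_finite)
  have co: "coord T (?f (p, M)) t = coord T p t + real (count M t)" if "t \<in> T" for p M t
    using that by (simp add: coord_add b coord_combination)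
  have \<eta>f: "\<eta> (?f (p, M)) = \<eta> p + real (size M)" if "set_mset M \<subseteq> T" for p M
  proof -
    have "\<eta> (?f (p, M)) = \<eta> p + (\<Sum>t\<in>T. real (count M t))"
      by (simp add: \<eta>_coord[OF T] co sum.distrib del: prod.case) (simp add: co[simplified] sum.distrib)
    also have "(\<Sum>t\<in>T. real (count M t)) = real (size M)"
      using that fin by (simp add: size_multiset_overloaded_eq flip: of_nat_sum)
        (intro sum.mono_neutral_right, auto simp: not_in_iff)
    finally show ?thesis .
  qed
  have \<eta>box: "0 \<le> \<eta> p" "real (nat \<lfloor>\<eta> p\<rfloor>) = \<eta> p" if "p \<in> half_open_box L q T" for p
  proof -
    show *: "0 \<le> \<eta> p" unfolding \<eta>_coord[OF T] using that
      by (intro sum_nonneg) (auto simp: half_open_box_def split: if_splits)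
    have "\<eta> p \<in> \<int>" using that \<eta>_L by (auto simp: half_open_box_def)
    then show "real (nat \<lfloor>\<eta> p\<rfloor>) = \<eta> p" using * by (auto elim: Ints_cases)
  qed
  show ?thesis
  proof (rule bij_betw_imageI)
    show "inj_on ?f ?A"
    proof (rule inj_onI, clarsimp)
      fix p M p' M'
      assume p: "p \<in> half_open_box L q T" "p' \<in> half_open_box L q T"
        and M: "M \<in> multisets_of_size T (k - nat \<lfloor>\<eta> p\<rfloor>)" "M' \<in> multisets_of_size T (k - nat \<lfloor>\<eta> p'\<rfloor>)"
        and eq: "p + multi_comb M T = p' + multi_comb M' T"
      have c: "count M t = count M' t" if t: "t \<in> T" for t
      proof -
        have "coord T p t + real (count M t) = coord T p' t + real (count M' t)"
          using co[OF t, of p M] co[OF t, of p' M'] eq by simp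
        moreover have "\<bar>coord T p t - coord T p' t\<bar> < 1"
          using p t by (force simp: half_open_box_def split: if_splits)
        ultimately have "\<bar>real (count M t) - real (count M' t)\<bar> < 1" by linarith
        then show ?thesis by linarith
      qed
      have "M = M'"
      proof (rule multiset_eqI)
        fix t show "count M t = count M' t"
          using c M by (metis multisets_of_size_subset count_eq_zero_iff subsetD)
      qed
      then show "p = p' \<and> M = M'" using eq by simp
    qed
    show "?f ` ?A = ?B"
    proof (intro equalityI subsetI)
      fix x assume "x \<in> ?f ` ?A"
      then obtain p M where pM: "x = ?f (p, M)" "p \<in> half_open_box L q T" "\<eta> p \<le> real k"
         "set_mset M \<subseteq> T" "size M = k - nat \<lfloor>\<eta> p\<rfloor>" by (auto simp: multisets_of_size_def)
      have "p \<in> L" using pM(2) by (simp add: half_open_box_def)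
      moreover have "multi_comb M T \<in> L" using b by (intro L_sum L_nat_scale) auto
      ultimately have "x \<in> L" using pM(1) L_add by simp
      moreover have "0 < coord T x t \<or> coord T x t = 0 \<and> 0 < coord T q t" if t: "t \<in> T" for t
        using pM(2) t co[OF t, of p M] unfolding pM(1) half_open_box_def
        by (cases "0 < coord T q t") force+
      then have "x \<in> half_open q T" by (simp add: half_open_def)
      moreover have "\<eta> x = real k" using \<eta>f[OF pM(4), of p] pM(1,3,5) \<eta>box[OF pM(2)] by auto
      ultimately show "x \<in> ?B" by simp
    next
      fix x assume "x \<in> ?B"
      then have x: "x \<in> L" "x \<in> half_open q T" "\<eta> x = real k" by auto
      define n where "n t = (if t \<in> T then nat (if 0 < coord T q t then \<lfloor>coord T x t\<rfloor> else \<lceil>coord T x t\<rceil> - 1) else 0)" for t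
      define M where "M = Abs_multiset n"
      have "{t. 0 < n t} \<subseteq> T" by (auto simp: n_def)
      then have "finite {t. 0 < n t}" using fin finite_subset by blast
      then have cM: "count M = n" by (simp add: M_def count_Abs_multiset)
      have setM: "set_mset M \<subseteq> T"
      proof
        fix t assume "t \<in># M"
        then have "n t \<noteq> 0" by (metis cM count_eq_zero_iff)
        then show "t \<in> T" by (simp add: n_def split: if_splits)
      qed
      define p where "p = x - multi_comb M T"
      have xf: "x = ?f (p, M)" by (simp add: p_def)
      have cp: "coord T p t = coord T x t - real (n t)" if "t \<in> T" for t
        using that by (simp add: p_def coord_diff b coord_combination cM)
      have pbox: "p \<in> half_open_box L q T"
        unfolding half_open_box_def mem_Collect_eq
      proof
        show "p \<in> L" unfolding p_def using x(1) b by (intro L_diff L_sum L_nat_scale) auto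
        show "\<forall>t\<in>T. if 0 < coord T q t then 0 \<le> coord T p t \<and> coord T p t < 1
                                          else 0 < coord T p t \<and> coord T p t \<le> 1"
        proof
          fix t assume t: "t \<in> T"
          show "if 0 < coord T q t then 0 \<le> coord T p t \<and> coord T p t < 1
                                          else 0 < coord T p t \<and> coord T p t \<le> 1"
          proof (cases "0 < coord T q t")
            case True
            have "real (n t) = of_int \<lfloor>coord T x t\<rfloor>" using True t half_open_nonneg[OF x(2) t] by (simp add: n_def)
            then show ?thesis using True cp[OF t] by simp linarith
          next
            case False
            then have "0 < coord T x t" using x(2) t by (auto simp: half_open_def)
            then have "real (n t) = of_int \<lceil>coord T x t\<rceil> - 1" using False t by (simp add: n_def)
            then show ?thesis using False cp[OF t] by simp linarith
          qed
        qed
      qed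
      have "\<eta> p + real (size M) = real k" using \<eta>f[OF setM, of p] x(3) xf by simp
      then have "\<eta> p \<le> real k" "size M = k - nat \<lfloor>\<eta> p\<rfloor>" using \<eta>box[OF pbox] by linarith+
      then have "(p, M) \<in> ?A" using pbox setM by (auto simp: multisets_of_size_def)
      then show "x \<in> ?f ` ?A" using xf by blast
    qed
  qed
qed

end

section \<open>Generic points and generic heights\<close>

text \<open>Having treated all functions but one, move from \<open>w\<close> a little towards a point where the last one is
  nonzero. The operation \<open>comb w s x\<close> stands for \<open>w + s x\<close>; it is a parameter so that the lemma
  applies to vectors as well as to height functions.\<close>

lemma common_nonzero:
  fixes F :: "('b \<Rightarrow> real) set"
  assumes "finite F"
    and affine: "\<And>f w s x. f \<in> F \<Longrightarrow> f (comb w s x) = f w + s * f x"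
    and nonzero: "\<And>f. f \<in> F \<Longrightarrow> \<exists>x. f x \<noteq> 0"
  shows "\<exists>w. \<forall>f\<in>F. f w \<noteq> 0"
  using assms
proof (induction F rule: finite_induct)
  case empty
  then show ?case by auto
next
  case (insert f F)
  obtain w where w: "\<forall>g\<in>F. g w \<noteq> 0" using insert by blast
  obtain x where x: "f x \<noteq> 0" using insert.prems by blast
  have "\<forall>\<^sub>F s in at_right 0. g w + s * g x \<noteq> 0" if "g \<in> insert f F" for g
  proof (cases "g x = 0")
    case True
    then show ?thesis using w x that by auto
  next
    case False
    then show ?thesis by (rule eventually_mono[OF eventually_sign_affine]) auto
  qed
  then have "\<forall>\<^sub>F s in at_right (0::real). \<forall>g\<in>insert f F. g w + s * g x \<noteq> 0"
    using insert.hyps by (subst eventually_ball_finite_distrib) auto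
  then obtain s where "\<forall>g\<in>insert f F. g w + s * g x \<noteq> 0"
    using eventually_at_right_0_ex by blast
  then have "\<forall>g\<in>insert f F. g (comb w s x) \<noteq> 0"
    using insert.prems(1) by simp
  then show ?case by blast
qed

lemma finite_bases_in: "finite V \<Longrightarrow> finite (bases_in V)"
  unfolding bases_in_def by (rule finite_subset[of _ "Pow V"]) auto

lemma generic_point_exists:
  fixes V :: "'a::real_vector set"
  assumes "finite V" shows "\<exists>w. generic_point w V"
proof -
  define F where "F = (\<lambda>(T, t). \<lambda>x. coord T x t) ` (SIGMA T:bases_in V. T)"
  have "finite F" unfolding F_def
    by (intro finite_imageI finite_SigmaI finite_bases_in assms) (simp add: bases_in_def basis_def)
  moreover have "f (w + s *\<^sub>R x) = f w + s * f x" if "f \<in> F" for f s w x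
    using that by (auto simp: F_def bases_in_def coord_add coord_scale)
  moreover have "\<exists>x. f x \<noteq> 0" if "f \<in> F" for f
    using that by (auto simp: F_def bases_in_def) (metis coord_basis zero_neq_one)
  ultimately have "\<exists>w. \<forall>f\<in>F. f w \<noteq> 0"
    by (rule common_nonzero[where comb = "\<lambda>w s x. w + s *\<^sub>R x"])
  then show ?thesis by (auto simp: F_def generic_point_def)
qed

lemma eventually_generic_point:
  fixes V :: "'a::real_vector set"
  assumes "finite V" "generic_point w V"
  shows "\<forall>\<^sub>F e in at_right 0. generic_point (x + e *\<^sub>R w) V"
  unfolding generic_point_def
  using assms by (subst eventually_ball_finite_distrib[OF finite_bases_in])
     (auto simp: generic_point_def bases_in_def intro!: eventually_mono[OF eventually_half_open])

lemma lift_at_fun_add: "lift_at (\<lambda>u. \<omega> u + s * \<rho> u) T x = lift_at \<omega> T x + s * lift_at \<rho> T x"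
  by (simp add: lift_at_def algebra_simps sum.distrib sum_distrib_left)

lemma lift_at_indicator: 
  "basis T \<Longrightarrow> lift_at (\<lambda>u. if u = a then 1 else 0) T x = coord T x a"
  using real_vector.representation_ne_zero[of T x a]
  by (auto simp: lift_at_def basis_finite if_distrib[of "\<lambda>c. _ * c"] cong: if_cong)

lemma generic_lift_exists:
  fixes V :: "'a::real_vector set"
  assumes "finite V" shows "\<exists>\<rho>. generic_lift \<rho> V"
proof -
  define F where "F = (\<lambda>(T, v). \<lambda>\<rho>. \<rho> v - lift_at \<rho> T v) ` (SIGMA T:bases_in V. V - T)"
  have "finite F" unfolding F_def
    by (intro finite_imageI finite_SigmaI finite_bases_in assms) (use assms in auto)
  moreover have "f (\<lambda>u. w u + s * x u) = f w + s * f x" if "f \<in> F" for f s w x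
    using that by (auto simp: F_def lift_at_fun_add algebra_simps)
  moreover have "\<exists>x. f x \<noteq> 0" if "f \<in> F" for f
  proof -
    obtain T v where f: "f = (\<lambda>\<rho>. \<rho> v - lift_at \<rho> T v)" "T \<in> bases_in V" "v \<in> V - T"
      using \<open>f \<in> F\<close> by (auto simp: F_def)
    have "f (\<lambda>u. if u = v then 1 else 0) = 1"
      using f real_vector.representation_ne_zero[of T v v]
      by (auto simp: lift_at_indicator bases_in_def)
    then show ?thesis by (metis zero_neq_one)
  qed
  ultimately have "\<exists>w. \<forall>f\<in>F. f w \<noteq> 0"
    by (rule common_nonzero[where comb = "\<lambda>w s x. (\<lambda>u. w u + s * x u)"])
  then obtain w where w: "\<forall>f\<in>F. f w \<noteq> 0" by blast
  have "lift_at w T v \<noteq> w v" if "T \<in> bases_in V" "v \<in> V - T" for T v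
  proof -
    have "(\<lambda>\<rho>. \<rho> v - lift_at \<rho> T v) \<in> F" unfolding F_def using that by (intro image_eqI[of _ _ "(T, v)"]) auto
    then show ?thesis using w by fastforce
  qed
  then show ?thesis by (auto simp: generic_lift_def)
qed

text \<open>Perturb \<open>\<omega>\<^sub>0\<close> to make it generic, so little that strict inequalities survive, and then lower the
  height of \<open>a\<close> until it is below the hyperplanes of all bases that do not contain it. Then \<open>a\<close> is in every
  cell. Generators in the cone over \<open>T\<close> but outside \<open>T\<close> stay below the hyperplane of \<open>T\<close>, as the
  height of \<open>a\<close> does not enter that inequality; so such a \<open>T\<close> is not a cell.\<close>

lemma star_lift_exists:
  fixes V :: "'a::real_vector set"
  assumes V: "finite V"
    and conv: "\<And>T v. \<lbrakk>T \<in> bases_in V; v \<in> V - T; v \<noteq> a; v \<in> nonneg_span T\<rbrakk> \<Longrightarrow>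
                coord T v a = 0 \<and> \<omega>\<^sub>0 v < lift_at \<omega>\<^sub>0 T v"
    and a: "a \<in> V"
  shows "\<exists>\<omega>. generic_lift \<omega> V \<and> (\<forall>T\<in>lower_bases \<omega> V. a \<in> T \<and> V \<inter> nonneg_span T \<subseteq> T)"
proof -
  obtain \<rho> where \<rho>: "generic_lift \<rho> V" using generic_lift_exists[OF V] by blast
  define g where "g \<omega> = (\<lambda>(T, v). lift_at \<omega> T v - \<omega> v)" for \<omega> :: "'a \<Rightarrow> real"
  let ?A = "SIGMA T:bases_in V. V - T"
  have fin: "finite ?A" using V finite_bases_in by (intro finite_SigmaI) auto
  have g_add: "g (\<lambda>u. \<omega> u + s * \<omega>' u) i = g \<omega> i + s * g \<omega>' i" for \<omega> \<omega>' s i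
    by (cases i) (simp add: g_def lift_at_fun_add algebra_simps)
  have "\<forall>\<^sub>F e in at_right 0. \<forall>i\<in>?A. g \<omega>\<^sub>0 i + e * g \<rho> i \<noteq> 0 \<and> 
     (0 < g \<omega>\<^sub>0 i + e * g \<rho> i \<longleftrightarrow> 0 < g \<omega>\<^sub>0 i \<or> g \<omega>\<^sub>0 i = 0 \<and> 0 < g \<rho> i)"
  proof (subst eventually_ball_finite_distrib[OF fin], intro ballI eventually_sign_affine)
    fix i assume "i \<in> ?A"
    then show "g \<rho> i \<noteq> 0" using \<rho> by (auto simp: g_def generic_lift_def)
  qed
  then obtain e where e: "\<forall>i\<in>?A. g \<omega>\<^sub>0 i + e * g \<rho> i \<noteq> 0 \<and> 
     (0 < g \<omega>\<^sub>0 i + e * g \<rho> i \<longleftrightarrow> 0 < g \<omega>\<^sub>0 i \<or> g \<omega>\<^sub>0 i = 0 \<and> 0 < g \<rho> i)"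
    using eventually_at_right_0_ex by blast
  define \<omega>\<^sub>1 where "\<omega>\<^sub>1 u = \<omega>\<^sub>0 u + e * \<rho> u" for u
  have g1: "g \<omega>\<^sub>1 i = g \<omega>\<^sub>0 i + e * g \<rho> i" for i
    unfolding \<omega>\<^sub>1_def by (rule g_add)
  let ?\<delta> = "\<lambda>u. if u = a then 1 else (0::real)"
  have \<delta>: "g ?\<delta> (T, v) = coord T v a - (if v = a then 1 else 0)" if "T \<in> bases_in V" for T v
    using that by (simp add: g_def lift_at_indicator bases_in_def)
  \<comment> \<open>For a basis without \<open>a\<close> the functional \<open>g ?\<delta>\<close> is \<open>-1\<close> at \<open>a\<close>, so lowering \<open>a\<close> puts \<open>a\<close> below
    its hyperplane. The other values of \<open>g ?\<delta>\<close> only affect genericity.\<close>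
  have "\<forall>\<^sub>F s in at_top. g \<omega>\<^sub>1 i - s * g ?\<delta> i \<noteq> 0 \<and> (g ?\<delta> i < 0 \<longrightarrow> 0 < g \<omega>\<^sub>1 i - s * g ?\<delta> i)"
    if "i \<in> ?A" for i
  proof -
    consider "g ?\<delta> i = 0" | "g ?\<delta> i > 0" | "g ?\<delta> i < 0" by linarith
    then show ?thesis
    proof cases
      case 1 then show ?thesis using e that by (auto simp: g1)
    next
      case 2
      show ?thesis by (rule eventually_mono[OF eventually_gt_at_top[of "g \<omega>\<^sub>1 i / g ?\<delta> i"]])
          (use 2 in \<open>auto simp: field_simps\<close>)
    next
      case 3
      show ?thesis by (rule eventually_mono[OF eventually_gt_at_top[of "g \<omega>\<^sub>1 i / g ?\<delta> i"]])
          (use 3 in \<open>auto simp: field_simps\<close>)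
    qed
  qed
  then have "\<forall>\<^sub>F s in at_top. \<forall>i\<in>?A. g \<omega>\<^sub>1 i - s * g ?\<delta> i \<noteq> 0 \<and> (g ?\<delta> i < 0 \<longrightarrow> 0 < g \<omega>\<^sub>1 i - s * g ?\<delta> i)"
    by (subst eventually_ball_finite_distrib[OF fin]) auto
  from eventually_happens'[OF trivial_limit_at_top_linorder this]
  obtain s where s: "\<forall>i\<in>?A. g \<omega>\<^sub>1 i - s * g ?\<delta> i \<noteq> 0 \<and> (g ?\<delta> i < 0 \<longrightarrow> 0 < g \<omega>\<^sub>1 i - s * g ?\<delta> i)"
    by blast
  define \<omega> where "\<omega> u = \<omega>\<^sub>1 u + (-s) * ?\<delta> u" for u
  have g: "g \<omega> i = g \<omega>\<^sub>1 i - s * g ?\<delta> i" for i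
    unfolding \<omega>_def[abs_def] by (subst g_add) simp
  have "generic_lift \<omega> V"
    unfolding generic_lift_def
  proof (intro ballI)
    fix T v assume "T \<in> bases_in V" "v \<in> V - T"
    then have "(T, v) \<in> ?A" by simp
    then have "g \<omega> (T, v) \<noteq> 0" using s g by simp
    then show "lift_at \<omega> T v \<noteq> \<omega> v" by (simp add: g_def)
  qed
  moreover have "a \<in> T" if T: "T \<in> lower_bases \<omega> V" for T
  proof (rule ccontr)
    assume "a \<notin> T"
    then have i: "(T, a) \<in> ?A" "coord T a a = 0"
      using T a real_vector.representation_ne_zero[of T a a] by (auto simp: lower_bases_def)
    then have "g ?\<delta> (T, a) < 0" using \<delta>[of T a] by auto
    then have "0 < g \<omega> (T, a)" using s i(1) unfolding g by blast
    moreover have "lift_at \<omega> T a < \<omega> a" using T i(1) by (simp add: lower_bases_def)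
    ultimately show False by (simp add: g_def)
  qed
  moreover have "v \<in> T" if T: "T \<in> lower_bases \<omega> V" and v: "v \<in> V" "v \<in> nonneg_span T" for T v
  proof (rule ccontr)
    assume "v \<notin> T"
    then have i: "(T, v) \<in> ?A" and va: "v \<noteq> a"
      using T v calculation(2) by (auto simp: lower_bases_def)
    then have *: "coord T v a = 0" "0 < g \<omega>\<^sub>0 (T, v)" using conv[of T v] v by (auto simp: g_def)
    then have "0 < g \<omega>\<^sub>1 (T, v)" using e i unfolding g1 by blast
    moreover have "g ?\<delta> (T, v) = 0" using \<delta> i * va by auto
    ultimately have "0 < g \<omega> (T, v)" by (simp add: g)
    moreover have "lift_at \<omega> T v < \<omega> v" using T i by (simp add: lower_bases_def)
    ultimately show False by (simp add: g_def)
  qed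
  ultimately show ?thesis by blast
qed

section \<open>Lattice points of the cone by height\<close>

context lattice_cone
begin

lemma \<eta>_pos_coord:
  assumes "T \<in> bases_in V" "0 < \<eta> q" shows "\<exists>t\<in>T. 0 < coord T q t"
proof (rule ccontr)
  assume "\<not> ?thesis"
  then have "(\<Sum>t\<in>T. coord T q t) \<le> 0" by (intro sum_nonpos) (simp add: not_less)
  then show False using assms \<eta>_coord[of T q] by simp
qed

text \<open>All coordinates of a box point are at most one, and one of them is less than one because some
  coordinate of \<open>q\<close> is positive.\<close>

lemma box_height:
  assumes T: "T \<in> bases_in V" and q: "0 < \<eta> q" and p: "p \<in> half_open_box L q T"
  shows "\<exists>j<DIM('a). \<eta> p = real j"
proof -
  have fin: "finite T" and c: "card T = DIM('a)" using T by (auto simp: bases_in_def basis_finite card_basis)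
  have "0 \<le> \<eta> p" unfolding \<eta>_coord[OF T] using p
    by (intro sum_nonneg) (auto simp: half_open_box_def split: if_splits)
  moreover have "\<eta> p \<in> \<int>" using p \<eta>_L by (auto simp: half_open_box_def)
  moreover have "\<eta> p < (\<Sum>t\<in>T. 1)"
    unfolding \<eta>_coord[OF T] using p \<eta>_pos_coord[OF T q] fin
    by (intro sum_strict_mono_ex1) (force simp: half_open_box_def split: if_splits)+
  ultimately show ?thesis using c
    by (intro exI[of _ "nat \<lfloor>\<eta> p\<rfloor>"]) (auto elim!: Ints_cases)
qed

text \<open>For \<open>q\<close> in the interior of the cone this is the \<open>j\<close>-th entry of the h*-vector.\<close>

definition box_count :: "'a \<Rightarrow> nat \<Rightarrow> nat" where
  "box_count q j = (\<Sum>T\<in>cells. card {p \<in> half_open_box L q T. \<eta> p = real j})"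

text \<open>A box point of height \<open>j\<close> contributes the multisets of size \<open>k - j\<close>. For \<open>j > k\<close> the binomial
  coefficient vanishes because \<open>j\<close> is less than the dimension, so the formula holds from \<open>k = 0\<close> on.\<close>

lemma half_open_level_card:
  assumes T: "T \<in> bases_in V" and q: "\<forall>t\<in>T. coord T q t \<noteq> 0" "0 < \<eta> q"
  shows "finite {x \<in> L \<inter> half_open q T. \<eta> x = real k}"
    and "card {x \<in> L \<inter> half_open q T. \<eta> x = real k} =
     (\<Sum>j<DIM('a). card {p \<in> half_open_box L q T. \<eta> p = real j} * ((k + (DIM('a) - 1 - j)) choose (DIM('a) - 1)))"
proof -
  let ?d = "DIM('a)"
  let ?B = "half_open_box L q T"
  let ?h = "\<lambda>p. nat \<lfloor>\<eta> p\<rfloor>"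
  let ?g = "\<lambda>j. (k + (?d - 1 - j)) choose (?d - 1)"
  have b: "basis T" using T by (simp add: bases_in_def)
  have fin: "finite T" and c: "card T = ?d" using b by (auto simp: basis_finite card_basis)
  have finB: "finite ?B" using finite_box b by blast
  have h: "?h p < ?d" "\<eta> p = real (?h p)" if "p \<in> ?B" for p
    using box_height[OF T q(2) that] by auto
  note bij = half_open_level_bij[OF T q(1), of k]
  have finS: "finite (SIGMA p:{p\<in>?B. \<eta> p \<le> real k}. multisets_of_size T (k - ?h p))"
    using finB fin by (intro finite_SigmaI) auto
  show "finite {x \<in> L \<inter> half_open q T. \<eta> x = real k}"
    using bij_betw_finite[OF bij] finS by blast
  have "card {x \<in> L \<inter> half_open q T. \<eta> x = real k} =
      card (SIGMA p:{p\<in>?B. \<eta> p \<le> real k}. multisets_of_size T (k - ?h p))"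
    using bij_betw_same_card[OF bij] by simp
  also have "\<dots> = (\<Sum>p\<in>{p\<in>?B. \<eta> p \<le> real k}. card (multisets_of_size T (k - ?h p)))"
    using finB fin by (intro card_SigmaI) auto
  also have "\<dots> = (\<Sum>p\<in>{p\<in>?B. \<eta> p \<le> real k}. ?g (?h p))"
  proof (rule sum.cong[OF refl])
    fix p assume p: "p \<in> {p\<in>?B. \<eta> p \<le> real k}"
    then have le: "?h p \<le> k" "?h p < ?d" using h[of p] by auto
    have "card (multisets_of_size T (k - ?h p)) = (?d + (k - ?h p) - 1) choose (k - ?h p)"
      by (simp add: card_multisets_of_size fin c)
    also have "\<dots> = (?d + (k - ?h p) - 1) choose (?d - 1)"
      using le by (subst binomial_symmetric) auto
    also have "?d + (k - ?h p) - 1 = k + (?d - 1 - ?h p)" using le by linarith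
    finally show "card (multisets_of_size T (k - ?h p)) = ?g (?h p)" .
  qed
  also have "\<dots> = (\<Sum>p\<in>?B. ?g (?h p))"
  proof (rule sum.mono_neutral_left[OF finB])
    show "\<forall>p\<in>?B - {p\<in>?B. \<eta> p \<le> real k}. ?g (?h p) = 0"
    proof
      fix p assume "p \<in> ?B - {p\<in>?B. \<eta> p \<le> real k}"
      then have "k < ?h p" "?h p < ?d" using h[of p] by auto
      then show "?g (?h p) = 0" by (intro binomial_eq_0) linarith
    qed
  qed auto
  also have "\<dots> = (\<Sum>j<?d. \<Sum>p\<in>{p\<in>?B. ?h p = j}. ?g (?h p))"
    by (rule sum.group[symmetric]) (use h finB in auto)
  also have "\<dots> = (\<Sum>j<?d. card {p\<in>?B. \<eta> p = real j} * ?g j)"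
  proof (rule sum.cong[OF refl])
    fix j
    have "{p\<in>?B. ?h p = j} = {p\<in>?B. \<eta> p = real j}" using h by auto
    then show "(\<Sum>p\<in>{p\<in>?B. ?h p = j}. ?g (?h p)) = card {p\<in>?B. \<eta> p = real j} * ?g j"
      using h by simp
  qed
  finally show "card {x \<in> L \<inter> half_open q T. \<eta> x = real k} = (\<Sum>j<?d. card {p\<in>?B. \<eta> p = real j} * ?g j)" .
qed

lemma generic_point_cell: "generic_point q V \<Longrightarrow> T \<in> cells \<Longrightarrow> \<forall>t\<in>T. coord T q t \<noteq> 0"
  using cell_in_bases by (simp add: generic_point_def)

lemma cone_push: "q \<in> nonneg_span V \<Longrightarrow> x \<in> nonneg_span V \<Longrightarrow> \<forall>\<^sub>F e in at_right 0. x + e *\<^sub>R q \<in> nonneg_span V"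
  by (rule eventually_mono[OF eventually_at_right_less])
    (auto intro!: nonneg_span_add nonneg_span_scale)

lemma cone_level_card:
  assumes q: "generic_point q V" "q \<in> nonneg_span V" "0 < \<eta> q"
  shows "finite {x \<in> L \<inter> nonneg_span V. \<eta> x = real k}"
    and "card {x \<in> L \<inter> nonneg_span V. \<eta> x = real k} =
     (\<Sum>j<DIM('a). box_count q j * ((k + (DIM('a) - 1 - j)) choose (DIM('a) - 1)))"
proof -
  have part: "\<exists>!T. T \<in> cells \<and> x \<in> half_open q T" if "x \<in> nonneg_span V" for x
    using half_open_partition[OF q(1) cone_push[OF q(2) that]] .
  have eq: "{x \<in> L \<inter> nonneg_span V. \<eta> x = real k} = (\<Union>T\<in>cells. {x \<in> L \<inter> half_open q T. \<eta> x = real k})"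
  proof (intro equalityI subsetI)
    fix x assume x: "x \<in> {x \<in> L \<inter> nonneg_span V. \<eta> x = real k}"
    then obtain T where "T \<in> cells" "x \<in> half_open q T" using part by blast
    then show "x \<in> (\<Union>T\<in>cells. {x \<in> L \<inter> half_open q T. \<eta> x = real k})" using x by blast
  next
    fix x assume "x \<in> (\<Union>T\<in>cells. {x \<in> L \<inter> half_open q T. \<eta> x = real k})"
    then obtain T where "T \<in> cells" "x \<in> L \<inter> half_open q T" "\<eta> x = real k" by blast
    then show "x \<in> {x \<in> L \<inter> nonneg_span V. \<eta> x = real k}" using half_open_sub_cone by blast
  qed
  have disj: "T = S" if "T \<in> cells" "S \<in> cells" "x \<in> half_open q T" "x \<in> half_open q S" for T S x
  proof -
    have "x \<in> nonneg_span V" using half_open_sub_cone that by blast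
    then show ?thesis using part that by blast
  qed
  note lv = half_open_level_card[OF cell_in_bases generic_point_cell[OF q(1)] q(3)]
  show "finite {x \<in> L \<inter> nonneg_span V. \<eta> x = real k}"
    unfolding eq using lv(1) finite_cells by auto
  have "card {x \<in> L \<inter> nonneg_span V. \<eta> x = real k} = (\<Sum>T\<in>cells. card {x \<in> L \<inter> half_open q T. \<eta> x = real k})"
    unfolding eq using lv(1) finite_cells disj by (intro card_UN_disjoint) blast+
  also have "\<dots> = (\<Sum>T\<in>cells. \<Sum>j<DIM('a). card {p \<in> half_open_box L q T. \<eta> p = real j} * ((k + (DIM('a) - 1 - j)) choose (DIM('a) - 1)))"
    by (intro sum.cong refl lv(2))
  also have "\<dots> = (\<Sum>j<DIM('a). \<Sum>T\<in>cells. card {p \<in> half_open_box L q T. \<eta> p = real j} * ((k + (DIM('a) - 1 - j)) choose (DIM('a) - 1)))"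
    by (rule sum.swap)
  finally show "card {x \<in> L \<inter> nonneg_span V. \<eta> x = real k} =
     (\<Sum>j<DIM('a). box_count q j * ((k + (DIM('a) - 1 - j)) choose (DIM('a) - 1)))"
    by (simp add: box_count_def sum_distrib_right)
qed

text \<open>The origin is the only point of height zero in the cone; compare both sides at \<open>k = 0\<close>.\<close>

lemma box_count_0:
  assumes q: "generic_point q V" "q \<in> nonneg_span V" "0 < \<eta> q"
  shows "box_count q 0 = 1"
proof -
  have "x = 0" if x: "x \<in> nonneg_span V" "\<eta> x = 0" for x
  proof -
    obtain c where c: "x = (\<Sum>v\<in>V. c v *\<^sub>R v)" "\<forall>v\<in>V. 0 \<le> c v" using x(1) by (auto simp: nonneg_span_def)
    have "\<eta> x = (\<Sum>v\<in>V. c v)" by (simp add: c(1) linear_sum[OF linear_\<eta>] linear_scale[OF linear_\<eta>] \<eta>_V)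
    then have "\<forall>v\<in>V. c v = 0" using that c(2) finite_V by (simp add: sum_nonneg_eq_0_iff)
    then show ?thesis by (simp add: c(1))
  qed
  then have "{x \<in> L \<inter> nonneg_span V. \<eta> x = real 0} = {0}"
    using zero_L zero_in_nonneg_span linear_0[OF linear_\<eta>] by auto
  then have "1 = card {x \<in> L \<inter> nonneg_span V. \<eta> x = real 0}" by simp
  also have "\<dots> = (\<Sum>j<DIM('a). box_count q j * ((0 + (DIM('a) - 1 - j)) choose (DIM('a) - 1)))"
    by (rule cone_level_card(2)[OF q])
  also have "\<dots> = (\<Sum>j\<in>{0}. box_count q j * ((0 + (DIM('a) - 1 - j)) choose (DIM('a) - 1)))"
    by (intro sum.mono_neutral_right) auto
  finally show ?thesis by simp
qed

lemma box_reflect: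
  assumes T: "T \<in> bases_in V" and q: "\<forall>t\<in>T. coord T q t \<noteq> 0" and p: "p \<in> half_open_box L q T"
  shows "(\<Sum>t\<in>T. t) - p \<in> half_open_box L (- q) T" "\<eta> ((\<Sum>t\<in>T. t) - p) = real DIM('a) - \<eta> p"
proof -
  have b: "basis T" "T \<subseteq> L" using T V_L by (auto simp: bases_in_def)
  have c: "coord T ((\<Sum>t\<in>T. t) - p) t = 1 - coord T p t" if "t \<in> T" for t
    using coord_combination[OF b(1) that, of "\<lambda>_. 1"] by (simp add: coord_diff b)
  show "(\<Sum>t\<in>T. t) - p \<in> half_open_box L (- q) T"
    using p q b unfolding half_open_box_def
    by (auto simp: c coord_minus intro!: L_diff L_sum split: if_splits)
  show "\<eta> ((\<Sum>t\<in>T. t) - p) = real DIM('a) - \<eta> p"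
    using card_basis[OF b(1)] by (simp add: \<eta>_coord[OF T] c sum_subtractf)
qed

text \<open>The half-open cones for \<open>- q\<close> partition the points from which one can step backwards. At height
  one such a point is itself a box point, since a box point of height zero would require all
  coordinates of \<open>q\<close> to be negative. Subtraction from the sum of the basis exchanges the boxes of
  \<open>- q\<close> and \<open>q\<close> and complements the height.\<close>

lemma interior_level_one:
  assumes q: "generic_point q V" "0 < \<eta> q"
  shows "card {x \<in> L. \<eta> x = 1 \<and> (\<forall>\<^sub>F e in at_right 0. x - e *\<^sub>R q \<in> nonneg_span V)} = box_count q (DIM('a) - 1)"
proof -
  have q': "generic_point (- q) V" using q(1) by (auto simp: generic_point_def bases_in_def coord_minus)
  let ?I = "{x \<in> L. \<eta> x = 1 \<and> (\<forall>\<^sub>F e in at_right 0. x - e *\<^sub>R q \<in> nonneg_span V)}"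
  let ?J = "\<lambda>T. {p \<in> half_open_box L (- q) T. \<eta> p = 1}"
  have level1: "x \<in> half_open (- q) T \<longleftrightarrow> x \<in> half_open_box L (- q) T" 
    if T: "T \<in> cells" and x: "x \<in> L" "\<eta> x = 1" for x T
  proof
    assume h: "x \<in> half_open (- q) T"
    have b: "basis T" "T \<in> bases_in V" using T by (auto simp: cell_basis cell_in_bases)
    note nn = half_open_nonneg[OF h]
    have sum1: "(\<Sum>t\<in>T. coord T x t) = 1" using \<eta>_coord[OF b(2), of x] x by simp
    have le1: "coord T x t \<le> 1" if "t \<in> T" for t
      using member_le_sum[of t T "coord T x"] nn that basis_finite[OF b(1)] sum1 by auto
    have lt1: "coord T x t < 1" if t: "t \<in> T" "coord T q t < 0" for t
    proof (rule ccontr)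
      assume "\<not> ?thesis"
      then have "coord T x t = 1" using le1 t by force
      then have "(\<Sum>u\<in>T - {t}. coord T x u) = 0"
        using sum1 t basis_finite[OF b(1)] by (simp add: sum.remove)
      then have z: "\<forall>u\<in>T - {t}. coord T x u = 0"
        using nn basis_finite[OF b(1)] by (subst (asm) sum_nonneg_eq_0_iff) auto
      have "coord T q u \<le> 0" if u: "u \<in> T" for u
      proof (cases "u = t")
        case True
        then show ?thesis using t by simp
      next
        case False
        then have "coord T x u = 0" using z u by blast
        then show ?thesis using h u by (force simp: half_open_def coord_minus b)
      qed
      then show False using \<eta>_pos_coord[OF b(2) q(2)] by force
    qed
    show "x \<in> half_open_box L (- q) T"
      using h nn le1 lt1 generic_point_cell[OF q(1) T] x
      by (auto simp: half_open_box_def half_open_def coord_minus b)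
  next
    assume "x \<in> half_open_box L (- q) T"
    then show "x \<in> half_open (- q) T" using generic_point_cell[OF q' T]
      by (force simp: half_open_box_def half_open_def split: if_splits)
  qed
  have part: "\<exists>!T. T \<in> cells \<and> x \<in> half_open (- q) T" if "x \<in> ?I" for x
    using half_open_partition[OF q'] that by simp
  have "?I = (\<Union>T\<in>cells. ?J T)"
  proof (intro equalityI subsetI)
    fix x assume x: "x \<in> ?I"
    then obtain T where "T \<in> cells" "x \<in> half_open (- q) T" using part by blast
    then show "x \<in> (\<Union>T\<in>cells. ?J T)" using level1 x by blast
  next
    fix x assume "x \<in> (\<Union>T\<in>cells. ?J T)"
    then obtain T where T: "T \<in> cells" "x \<in> half_open_box L (- q) T" "\<eta> x = 1" by auto
    then have x: "x \<in> L" by (simp add: half_open_box_def)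
    then have "x \<in> half_open (- q) T" using level1 T by blast
    then show "x \<in> ?I" using half_open_push[OF q' T(1)] x T by simp
  qed
  moreover have "finite (?J T)" if "T \<in> cells" for T using finite_box[OF cell_basis[OF that]] by simp
  moreover have "?J T \<inter> ?J S = {}" if "T \<in> cells" "S \<in> cells" "T \<noteq> S" for T S
  proof (rule ccontr)
    assume "?J T \<inter> ?J S \<noteq> {}"
    then obtain x where x: "x \<in> half_open_box L (- q) T" "x \<in> half_open_box L (- q) S" "\<eta> x = 1" by blast
    then have "x \<in> L" by (simp add: half_open_box_def)
    then have *: "x \<in> half_open (- q) T" "x \<in> half_open (- q) S" using level1 that x by blast+
    then have "\<forall>\<^sub>F e in at_right 0. x + e *\<^sub>R - q \<in> nonneg_span V"
      using half_open_push[OF q' that(1)] by blast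
    then show False using half_open_partition[OF q'] * that by blast
  qed
  ultimately have "card ?I = (\<Sum>T\<in>cells. card (?J T))"
    using finite_cells by (simp add: card_UN_disjoint)
  also have "\<dots> = box_count q (DIM('a) - 1)"
    unfolding box_count_def
  proof (rule sum.cong[OF refl])
    fix T assume T: "T \<in> cells"
    let ?f = "\<lambda>p. (\<Sum>t\<in>T. t) - p"
    have "bij_betw ?f (?J T) {p \<in> half_open_box L q T. \<eta> p = real (DIM('a) - 1)}"
    proof (rule bij_betw_byWitness[where f' = ?f])
      show "?f ` ?J T \<subseteq> {p \<in> half_open_box L q T. \<eta> p = real (DIM('a) - 1)}"
        using box_reflect[OF cell_in_bases[OF T] generic_point_cell[OF q' T]] by auto
      show "?f ` {p \<in> half_open_box L q T. \<eta> p = real (DIM('a) - 1)} \<subseteq> ?J T"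
        using box_reflect[OF cell_in_bases[OF T] generic_point_cell[OF q(1) T]] by auto
    qed auto
    then show "card (?J T) = card {p \<in> half_open_box L q T. \<eta> p = real (DIM('a) - 1)}"
      by (rule bij_betw_same_card)
  qed
  finally show ?thesis .
qed

text \<open>Let all cells share the generator \<open>a\<close>, and let \<open>q\<close> and \<open>q'\<close> have opposite signs in the other
  coordinates. The origin lies in the half-open cone for \<open>q'\<close> of just one cell \<open>T0\<close>, the only one
  without negative coordinates of \<open>q'\<close>. A generator \<open>v\<close> lies in the half-open cone of some cell, and
  since all other coordinates of \<open>v\<close> vanish there, only the coordinate of \<open>q'\<close> at \<open>v\<close> can be negative.
  So the generators outside \<open>T0\<close> inject into the cells with exactly one negative coordinate of \<open>q'\<close>.
  In such a cell \<open>q\<close> has \<open>DIM('a) - 2\<close> negative coordinates, and the sum of the corresponding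
  generators is a box point of that height.\<close>

lemma star_bound:
  assumes q: "generic_point q V" and q': "generic_point q' V" "q' \<in> nonneg_span V"
    and a: "a \<in> V" and star: "\<forall>T\<in>cells. a \<in> T \<and> V \<inter> nonneg_span T \<subseteq> T"
    and qa: "\<forall>T\<in>cells. 0 < coord T q a \<and> 0 < coord T q' a"
    and opp: "\<forall>T\<in>cells. \<forall>t\<in>T - {a}. coord T q t < 0 \<longleftrightarrow> 0 < coord T q' t"
  shows "card V \<le> box_count q (DIM('a) - 2) + DIM('a)"
proof -
  let ?d = "DIM('a)"
  define N where "N q T = {t\<in>T. coord T q t < 0}" for q :: 'a and T
  define A where "A = {T\<in>cells. card (N q' T) = 1}"
  have part: "\<exists>!T. T \<in> cells \<and> x \<in> half_open q' T" if "x \<in> nonneg_span V" for x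
    using half_open_partition[OF q'(1) cone_push[OF q'(2) that]] .
  obtain T0 where T0: "T0 \<in> cells" "0 \<in> half_open q' T0" using part[OF zero_in_nonneg_span] by blast
  have T0_unique: "T = T0" if "T \<in> cells" "N q' T = {}" for T
  proof -
    have "0 < coord T q' t" if "t \<in> T" for t
      using \<open>N q' T = {}\<close> generic_point_cell[OF q'(1) \<open>T \<in> cells\<close>] \<open>t \<in> T\<close> by (fastforce simp: N_def)
    then have "0 \<in> half_open q' T" by (simp add: half_open_def)
    then show ?thesis using part[OF zero_in_nonneg_span] T0 \<open>T \<in> cells\<close> by blast
  qed
  define cell where "cell v = (THE T. T \<in> cells \<and> v \<in> half_open q' T)" for v
  have cell: "cell v \<in> cells" "v \<in> half_open q' (cell v)" if "v \<in> V" for v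
    using theI'[OF part[OF nonneg_span_base[OF finite_V that]]] by (auto simp: cell_def)
  have cell_N: "v \<in> cell v \<and> N q' (cell v) \<subseteq> {v}" if v: "v \<in> V" for v
  proof -
    have b: "basis (cell v)" using cell[OF v] cell_basis by blast
    have "v \<in> nonneg_span (cell v)"
      using half_open_nonneg[OF cell(2)[OF v]] nonneg_span_basis[OF b] by blast
    then have vT: "v \<in> cell v" using star cell(1)[OF v] v by blast
    moreover have "0 < coord (cell v) q' t" if "t \<in> cell v" "t \<noteq> v" for t
      using cell(2)[OF v] that coord_basis[OF b vT, of t] by (auto simp: half_open_def)
    ultimately show ?thesis by (force simp: N_def)
  qed
  have cell_N': "N q' (cell v) = {v}" if v: "v \<in> V - T0" for v
    using cell_N[of v] T0_unique[of "cell v"] cell(1)[of v] v by auto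
  have "inj_on cell (V - T0)" using cell_N' by (metis inj_onI singleton_inject)
  moreover have "cell ` (V - T0) \<subseteq> A" using cell_N' cell by (auto simp: A_def)
  ultimately have "card (V - T0) \<le> card A"
    using finite_cells by (intro card_inj_on_le) (auto simp: A_def)
  moreover have "card V = card (V - T0) + ?d"
    using cell_subset[OF T0(1)] card_basis[OF cell_basis[OF T0(1)]] finite_V
      card_mono[OF finite_V cell_subset[OF T0(1)]]
    by (simp add: card_Diff_subset basis_finite[OF cell_basis[OF T0(1)]])
  moreover have "card A \<le> box_count q (?d - 2)"
  proof -
    have "1 \<le> card {p \<in> half_open_box L q T. \<eta> p = real (?d - 2)}" if T: "T \<in> A" for T
    proof -
      have TD: "T \<in> cells" using T by (simp add: A_def)
      have b: "basis T" "T \<in> bases_in V" "T \<subseteq> L" and fin: "finite T"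
        using cell_basis[OF TD] cell_in_bases[OF TD] cell_subset[OF TD] V_L by (auto simp: basis_def)
      have aT: "a \<in> T" using star TD by blast
      have N: "N q T = (T - {a}) - N q' T"
      proof (intro equalityI subsetI)
        fix t assume "t \<in> N q T"
        then have t: "t \<in> T" "coord T q t < 0" by (auto simp: N_def)
        then have "t \<noteq> a" using qa TD by force
        then show "t \<in> (T - {a}) - N q' T" using opp TD t by (force simp: N_def)
      next
        fix t assume t: "t \<in> (T - {a}) - N q' T"
        then have "0 < coord T q' t" using generic_point_cell[OF q'(1) TD] by (force simp: N_def)
        then show "t \<in> N q T" using opp TD t by (force simp: N_def)
      qed
      have "N q' T \<subseteq> T - {a}" using qa TD by (force simp: N_def)
      then have "card (N q T) = card (T - {a}) - card (N q' T)"
        unfolding N using fin by (intro card_Diff_subset) (auto intro: finite_subset)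
      then have cN: "card (N q T) = ?d - 2"
        using T aT card_basis[OF b(1)] by (simp add: A_def)
      define p where "p = (\<Sum>t\<in>N q T. t)"
      have "p = (\<Sum>t\<in>T. (if t \<in> N q T then 1 else 0) *\<^sub>R t)"
        unfolding p_def using fin by (intro sum.mono_neutral_cong_left) (auto simp: N_def)
      then have cp: "coord T p t = (if t \<in> N q T then 1 else 0)" if "t \<in> T" for t
        using coord_combination[OF b(1) that] by simp
      have "p \<in> L" unfolding p_def using b(3) by (intro L_sum) (auto simp: N_def)
      then have "p \<in> half_open_box L q T"
        using generic_point_cell[OF q TD] by (auto simp: half_open_box_def cp N_def)
      moreover have "\<eta> p = real (?d - 2)"
      proof -
        have "\<eta> p = (\<Sum>t\<in>N q T. \<eta> t)" unfolding p_def by (rule linear_sum[OF linear_\<eta>])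
        also have "\<dots> = (\<Sum>t\<in>N q T. 1)"
          using cell_subset[OF TD] by (intro sum.cong) (auto simp: N_def \<eta>_V)
        finally show ?thesis using cN by simp
      qed
      ultimately have "p \<in> {p \<in> half_open_box L q T. \<eta> p = real (?d - 2)}" by simp
      moreover have "finite {p \<in> half_open_box L q T. \<eta> p = real (?d - 2)}"
        using finite_box[OF b(1)] by simp
      ultimately have "card {p \<in> half_open_box L q T. \<eta> p = real (?d - 2)} \<noteq> 0"
        using card_0_eq by blast
      then show ?thesis by linarith
    qed
    then have "(\<Sum>T\<in>A. 1) \<le> (\<Sum>T\<in>A. card {p \<in> half_open_box L q T. \<eta> p = real (?d - 2)})"
      by (rule sum_mono)
    also have "\<dots> \<le> box_count q (?d - 2)"
      unfolding box_count_def using finite_cells by (intro sum_mono2) (auto simp: A_def)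
    finally show ?thesis by simp
  qed
  ultimately show ?thesis by linarith
qed

end

section \<open>Homogenising a lattice polytope\<close>

abbreviation lift_point :: "real ^ 3 \<Rightarrow> (real ^ 3) \<times> real" where
  "lift_point y \<equiv> (y, 1)"

lemma finite_int_lattice_bounded:
  assumes "bounded S" shows "finite (int_lattice \<inter> S)"
proof -
  obtain M where M: "\<And>x. x \<in> S \<Longrightarrow> norm x \<le> M" using assms bounded_iff by blast
  have "(int_lattice \<inter> S) \<subseteq> (\<lambda>f. \<chi> i. of_int (f i)) ` (UNIV \<rightarrow>\<^sub>E {-\<lceil>M\<rceil>..\<lceil>M\<rceil>})"
  proof
    fix x assume x: "x \<in> int_lattice \<inter> S"
    have "x $ i = of_int \<lfloor>x $ i\<rfloor>" for i
    proof -
      have "x $ i \<in> \<int>" using x by (simp add: int_lattice_def)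
      then show ?thesis by (auto elim: Ints_cases)
    qed
    then have "x = (\<chi> i. of_int ((\<lambda>i. \<lfloor>x $ i\<rfloor>) i))" by (simp add: vec_eq_iff)
    moreover have "\<lfloor>x $ i\<rfloor> \<in> {-\<lceil>M\<rceil>..\<lceil>M\<rceil>}" for i
    proof -
      have "\<bar>x $ i\<bar> \<le> M" using component_le_norm_cart[of x i] M[of x] x by auto
      then show ?thesis by (auto simp: abs_le_iff) linarith+
    qed
    ultimately show "x \<in> (\<lambda>f. \<chi> i. of_int (f i)) ` (UNIV \<rightarrow>\<^sub>E {-\<lceil>M\<rceil>..\<lceil>M\<rceil>})"
      by (intro image_eqI[of _ _ "\<lambda>i. \<lfloor>x $ i\<rfloor>"]) auto
  qed
  then show ?thesis by (rule finite_subset) (intro finite_imageI finite_PiE, auto)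
qed

lemma finite_lattice_prod_bounded:
  assumes "bounded (S :: ((real ^ 3) \<times> real) set)" shows "finite ((int_lattice \<times> \<int>) \<inter> S)"
proof -
  have "bounded (fst ` S)" "bounded (snd ` S)"
    using assms bounded_fst bounded_snd by auto
  then obtain M where "\<And>x. x \<in> snd ` S \<Longrightarrow> \<bar>x\<bar> \<le> M" unfolding bounded_real by blast
  then have "\<int> \<inter> snd ` S \<subseteq> {k \<in> \<int>. \<bar>k\<bar> \<le> M}" by blast
  then have "finite (\<int> \<inter> snd ` S)" using finite_abs_int_segment finite_subset by blast
  moreover have "finite (int_lattice \<inter> fst ` S)"
    using finite_int_lattice_bounded \<open>bounded (fst ` S)\<close> by blast
  ultimately
  have "finite ((int_lattice \<inter> fst ` S) \<times> (\<int> \<inter> snd ` S))" by blast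
  then show ?thesis by (rule rev_finite_subset) force
qed

lemma span_lift_point:
  assumes "aff_dim W = 3" shows "span (lift_point ` W) = UNIV"
proof -
  have aff: "affine hull W = UNIV" using assms aff_dim_eq_full[of W] by simp
  have 1: "(y, 1) \<in> span (lift_point ` W)" for y
  proof -
    have "y \<in> affine hull W" by (simp add: aff)
    then obtain S u where S: "finite S" "S \<subseteq> W" "sum u S = 1" "(\<Sum>v\<in>S. u v *\<^sub>R v) = y"
      by (auto simp: affine_hull_explicit)
    then have "(y, 1::real) = (\<Sum>v\<in>S. u v *\<^sub>R (v, 1))"
      by (auto simp: prod_eq_iff fst_sum snd_sum)
    also have "\<dots> \<in> span (lift_point ` W)" using S by (intro span_sum span_scale span_base) auto
    finally show ?thesis .
  qed
  have "(y, s) \<in> span (lift_point ` W)" for y s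
  proof -
    have "(y, s) = (y, 1) + (s - 1) *\<^sub>R (0, 1)" by simp
    also have "\<dots> \<in> span (lift_point ` W)" by (intro span_add span_scale 1)
    finally show ?thesis .
  qed
  then show ?thesis by auto
qed

lemma int_lattice_diff: "x \<in> int_lattice \<Longrightarrow> y \<in> int_lattice \<Longrightarrow> x - y \<in> int_lattice"
  by (simp add: int_lattice_def)

lemma lattice_cone_lift:
  assumes "finite W" "W \<subseteq> int_lattice" "aff_dim W = 3" "generic_lift \<omega> (lift_point ` W)"
  shows "lattice_cone (lift_point ` W) (int_lattice \<times> \<int>) snd \<omega>"
proof (rule lattice_cone.intro)
  show "bounded S \<Longrightarrow> finite (int_lattice \<times> \<int> \<inter> S)" for S :: "((real ^ 3) \<times> real) set"
    by (rule finite_lattice_prod_bounded)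
  show "linear (snd :: (real ^ 3) \<times> real \<Rightarrow> real)" by (rule linear_snd)
qed (use assms span_lift_point int_lattice_diff in auto)

text \<open>A nonnegative combination of lifted points has the sum of its coefficients as last coordinate.\<close>

lemma lift_cone_level:
  assumes W: "finite W" "W \<noteq> {}" and k: "0 \<le> k"
  shows "(y, k) \<in> nonneg_span (lift_point ` W) \<longleftrightarrow> y \<in> (*\<^sub>R) k ` (convex hull W)"
proof -
  have inj: "inj_on lift_point W" by (auto intro: inj_onI)
  have "(y, k) \<in> nonneg_span (lift_point ` W) \<longleftrightarrow>
     (\<exists>c. (\<forall>v\<in>W. 0 \<le> c v) \<and> (\<Sum>v\<in>W. c v *\<^sub>R v) = y \<and> (\<Sum>v\<in>W. c v) = k)"
  proof
    assume "(y, k) \<in> nonneg_span (lift_point ` W)"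
    then obtain c where c: "(y, k) = (\<Sum>v\<in>lift_point ` W. c v *\<^sub>R v)" "\<forall>v\<in>lift_point ` W. 0 \<le> c v"
      by (auto simp: nonneg_span_def)
    then show "\<exists>c. (\<forall>v\<in>W. 0 \<le> c v) \<and> (\<Sum>v\<in>W. c v *\<^sub>R v) = y \<and> (\<Sum>v\<in>W. c v) = k"
      by (intro exI[of _ "c \<circ> lift_point"]) (auto simp: sum.reindex[OF inj] prod_eq_iff fst_sum snd_sum)
  next
    assume "\<exists>c. (\<forall>v\<in>W. 0 \<le> c v) \<and> (\<Sum>v\<in>W. c v *\<^sub>R v) = y \<and> (\<Sum>v\<in>W. c v) = k"
    then obtain c where "\<forall>v\<in>W. 0 \<le> c v" "(\<Sum>v\<in>W. c v *\<^sub>R v) = y" "(\<Sum>v\<in>W. c v) = k" by blast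
    then show "(y, k) \<in> nonneg_span (lift_point ` W)"
      unfolding nonneg_span_def
      by (auto simp: sum.reindex[OF inj] prod_eq_iff fst_sum snd_sum intro!: exI[of _ "c \<circ> fst"])
  qed
  also have "\<dots> \<longleftrightarrow> y \<in> (*\<^sub>R) k ` (convex hull W)"
  proof
    assume "\<exists>c. (\<forall>v\<in>W. 0 \<le> c v) \<and> (\<Sum>v\<in>W. c v *\<^sub>R v) = y \<and> (\<Sum>v\<in>W. c v) = k"
    then obtain c where c: "\<forall>v\<in>W. 0 \<le> c v" "(\<Sum>v\<in>W. c v *\<^sub>R v) = y" "(\<Sum>v\<in>W. c v) = k" by blast
    show "y \<in> (*\<^sub>R) k ` (convex hull W)"
    proof (cases "k = 0")
      case True
      then have "\<forall>v\<in>W. c v = 0" using c W by (simp add: sum_nonneg_eq_0_iff)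
      then have "y = 0" using c(2) by auto
      then show ?thesis using True W(2) by (auto simp: image_iff)
    next
      case False
      have "(\<Sum>v\<in>W. (c v / k) *\<^sub>R v) = (1 / k) *\<^sub>R y"
        by (simp add: scaleR_sum_right flip: c(2))
      moreover have "(\<Sum>v\<in>W. c v / k) = 1" using c(3) False by (simp flip: sum_divide_distrib)
      ultimately have "(1 / k) *\<^sub>R y \<in> convex hull W"
        unfolding convex_hull_finite[OF W(1)] using c(1) k by (auto intro!: exI[of _ "\<lambda>v. c v / k"])
      then show ?thesis using False by (intro image_eqI[of _ _ "(1 / k) *\<^sub>R y"]) auto
    qed
  next
    assume "y \<in> (*\<^sub>R) k ` (convex hull W)"
    then obtain u where u: "\<forall>v\<in>W. 0 \<le> u v" "(\<Sum>v\<in>W. u v) = 1" "y = k *\<^sub>R (\<Sum>v\<in>W. u v *\<^sub>R v)"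
      by (auto simp: convex_hull_finite[OF W(1)])
    then show "\<exists>c. (\<forall>v\<in>W. 0 \<le> c v) \<and> (\<Sum>v\<in>W. c v *\<^sub>R v) = y \<and> (\<Sum>v\<in>W. c v) = k"
      using k by (intro exI[of _ "\<lambda>v. k * u v"]) (auto simp: scaleR_sum_right simp flip: sum_distrib_left)
  qed
  finally show ?thesis .
qed

text \<open>Being in the interior of the cone over \<open>P\<close>, expressed by the dehomogenised point.\<close>

definition over_interior :: "(real ^ 3) \<times> real \<Rightarrow> (real ^ 3) set \<Rightarrow> bool" where
  "over_interior q P \<longleftrightarrow> 0 < snd q \<and> (1 / snd q) *\<^sub>R fst q \<in> interior P"

lemma over_interior_in_cone:
  assumes "finite W" "W \<noteq> {}" "over_interior q (convex hull W)"
  shows "q \<in> nonneg_span (lift_point ` W)"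
proof -
  have s: "0 < snd q" "(1 / snd q) *\<^sub>R fst q \<in> convex hull W"
    using assms(3) interior_subset by (auto simp: over_interior_def)
  then have "fst q \<in> (*\<^sub>R) (snd q) ` (convex hull W)"
    by (intro image_eqI[OF _ s(2)]) simp
  then have "(fst q, snd q) \<in> nonneg_span (lift_point ` W)"
    using s(1) lift_cone_level[OF assms(1,2), of "snd q" "fst q"] by simp
  then show ?thesis by simp
qed

lemma eventually_over_interior:
  assumes "a \<in> interior P"
  shows "\<forall>\<^sub>F e in at_right 0. over_interior ((a, 1) + e *\<^sub>R w) P"
proof -
  have "((\<lambda>e. 1 + e * snd w) \<longlongrightarrow> 1 + 0 * snd w) (at_right 0)" by (intro tendsto_intros)
  then have 1: "\<forall>\<^sub>F e in at_right 0. 0 < 1 + e * snd w" by (rule order_tendstoD(1)) simp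
  have "((\<lambda>e. (1 / (1 + e * snd w)) *\<^sub>R (a + e *\<^sub>R fst w)) \<longlongrightarrow> (1 / (1 + 0 * snd w)) *\<^sub>R (a + 0 *\<^sub>R fst w)) (at_right 0)"
    by (intro tendsto_intros) simp
  then have "((\<lambda>e. (1 / (1 + e * snd w)) *\<^sub>R (a + e *\<^sub>R fst w)) \<longlongrightarrow> a) (at_right 0)" by simp
  then have 2: "\<forall>\<^sub>F e in at_right 0. (1 / (1 + e * snd w)) *\<^sub>R (a + e *\<^sub>R fst w) \<in> interior P"
    using assms by (rule topological_tendstoD[OF _ open_interior])
  from 1 2 show ?thesis by eventually_elim (simp add: over_interior_def)
qed

text \<open>If \<open>y\<close> can be moved away from an interior point, it lies strictly between that point and a point of
  the polytope and is interior itself. Conversely an interior point stays inside after a small step.\<close>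

lemma retreat_iff_interior:
  assumes W: "finite W" "W \<noteq> {}" and q: "over_interior q (convex hull W)"
  shows "(\<forall>\<^sub>F e in at_right 0. (y, 1) - e *\<^sub>R q \<in> nonneg_span (lift_point ` W)) \<longleftrightarrow> y \<in> interior (convex hull W)"
proof
  let ?P = "convex hull W"
  assume "\<forall>\<^sub>F e in at_right 0. (y, 1) - e *\<^sub>R q \<in> nonneg_span (lift_point ` W)"
  moreover have "((\<lambda>e. e * snd q) \<longlongrightarrow> 0 * snd q) (at_right 0)" by (intro tendsto_intros)
  then have "\<forall>\<^sub>F e in at_right 0. e * snd q < 1" by (rule order_tendstoD(2)) simp
  ultimately have "\<forall>\<^sub>F e in at_right 0. (y, 1) - e *\<^sub>R q \<in> nonneg_span (lift_point ` W) \<and> e * snd q < 1"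
    by (rule eventually_conj)
  then obtain e where e: "0 < e" "(y - e *\<^sub>R fst q, 1 - e * snd q) \<in> nonneg_span (lift_point ` W)" "e * snd q < 1"
    using eventually_at_right_0_ex[of "\<lambda>e. (y, 1) - e *\<^sub>R q \<in> nonneg_span (lift_point ` W) \<and> e * snd q < 1"]
    by (cases q) auto
  have s: "0 < snd q" "(1 / snd q) *\<^sub>R fst q \<in> interior ?P" using q by (auto simp: over_interior_def)
  have "y - e *\<^sub>R fst q \<in> (*\<^sub>R) (1 - e * snd q) ` ?P" using e by (subst (asm) lift_cone_level[OF W]) auto
  then obtain z where z: "z \<in> ?P" "y - e *\<^sub>R fst q = (1 - e * snd q) *\<^sub>R z" by auto
  have "z - (e * snd q) *\<^sub>R (z - (1 / snd q) *\<^sub>R fst q) \<in> interior ?P"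
    using e s z by (intro mem_interior_convex_shrink convex_convex_hull) auto
  also have "z - (e * snd q) *\<^sub>R (z - (1 / snd q) *\<^sub>R fst q) = y"
    using z(2) s(1) by (simp add: algebra_simps)
  finally show "y \<in> interior ?P" .
next
  let ?P = "convex hull W"
  assume "y \<in> interior ?P"
  from eventually_over_interior[OF this, of "- q"]
  show "\<forall>\<^sub>F e in at_right 0. (y, 1) - e *\<^sub>R q \<in> nonneg_span (lift_point ` W)"
    by (rule eventually_mono) (use over_interior_in_cone[OF W] in fastforce)
qed

lemma sum_lessThan_4: "(\<Sum>j<(4::nat). f j) = f 0 + f 1 + f 2 + (f 3 :: nat)"
  by (simp add: numeral_eq_Suc)

text \<open>Points of height \<open>k\<close> in the cone are the points of the \<open>k\<close>-th dilate, and points of height one that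
  can be moved away from \<open>q\<close> are the interior points of the polytope.\<close>

lemma ehrhart_box_count:
  assumes W: "finite W" "W \<subseteq> int_lattice" "aff_dim W = 3" and \<omega>: "generic_lift \<omega> (lift_point ` W)"
    and q: "generic_point q (lift_point ` W)" "over_interior q (convex hull W)"
  defines "h \<equiv> lattice_cone.box_count (lift_point ` W) (int_lattice \<times> \<int>) snd \<omega> q"
  shows "card ((*\<^sub>R) (real k) ` (convex hull W) \<inter> int_lattice)
           = ((k + 3) choose 3) + h 1 * ((k + 2) choose 3) + h 2 * ((k + 1) choose 3) + h 3 * (k choose 3)"
    and "h 3 = card (interior (convex hull W) \<inter> int_lattice)"
proof -
  let ?V = "lift_point ` W" and ?L = "int_lattice \<times> (\<int> :: real set)" and ?P = "convex hull W"
  interpret lattice_cone ?V ?L snd \<omega> using lattice_cone_lift W \<omega> .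
  have ne: "W \<noteq> {}" using W(3) by auto
  have qc: "q \<in> nonneg_span ?V" "0 < snd q" using over_interior_in_cone[OF W(1) ne q(2)] q(2)
    by (auto simp: over_interior_def)
  have "bij_betw (\<lambda>y. (y, real k)) ((*\<^sub>R) (real k) ` ?P \<inter> int_lattice) {x \<in> ?L \<inter> nonneg_span ?V. snd x = real k}"
    by (rule bij_betw_byWitness[where f' = fst]) (auto simp: lift_cone_level[OF W(1) ne])
  then have "card ((*\<^sub>R) (real k) ` ?P \<inter> int_lattice) = card {x \<in> ?L \<inter> nonneg_span ?V. snd x = real k}"
    by (rule bij_betw_same_card)
  also have "\<dots> = (\<Sum>j<4. h j * ((k + (3 - j)) choose 3))"
    using cone_level_card(2)[OF q(1) qc, of k] by (simp add: h_def)
  also have "\<dots> = ((k + 3) choose 3) + h 1 * ((k + 2) choose 3) + h 2 * ((k + 1) choose 3) + h 3 * (k choose 3)"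
    using box_count_0[OF q(1) qc] by (simp add: sum_lessThan_4 h_def)
  finally show "card ((*\<^sub>R) (real k) ` ?P \<inter> int_lattice) = \<dots>" .
  have "bij_betw (\<lambda>y. (y, 1)) (interior ?P \<inter> int_lattice)
     {x \<in> ?L. snd x = 1 \<and> (\<forall>\<^sub>F e in at_right 0. x - e *\<^sub>R q \<in> nonneg_span ?V)}"
    by (rule bij_betw_byWitness[where f' = fst]) (auto simp: retreat_iff_interior[OF W(1) ne q(2)])
  from bij_betw_same_card[OF this] interior_level_one[OF q(1) qc(2)]
  show "h 3 = card (interior ?P \<inter> int_lattice)" by (simp add: h_def)
qed

lemma lattice_polytope_facts:
  assumes "P \<in> lattice_polytopes"
  shows "compact P" "convex P" "interior P \<noteq> {}" "{v. v extreme_point_of P} \<subseteq> frontier P \<inter> int_lattice"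
    "4 \<le> card {v. v extreme_point_of P}" "finite {v. v extreme_point_of P}"
    "P = convex hull {v. v extreme_point_of P}" "finite (P \<inter> int_lattice)"
proof -
  let ?E = "{v. v extreme_point_of P}"
  have P: "polytope P" "aff_dim P = 3" "?E \<subseteq> int_lattice" using assms by (auto simp: lattice_polytopes_def)
  show c: "compact P" "convex P" using P polytope_imp_compact polytope_imp_convex by auto
  have "affine hull P = UNIV" using P(2) aff_dim_eq_full[of P] by simp
  moreover have "P \<noteq> {}" using P(2) by auto
  ultimately show "interior P \<noteq> {}" using c(2) by (metis rel_interior_interior rel_interior_eq_empty)
  show "?E \<subseteq> frontier P \<inter> int_lattice"
  proof
    fix v assume v: "v \<in> ?E"
    then have "v \<in> P" "v \<notin> interior P"
      using extreme_point_not_in_interior[of v P] by (auto simp: extreme_point_of_def)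
    then show "v \<in> frontier P \<inter> int_lattice"
      using v P(3) closure_subset[of P] by (auto simp: frontier_def)
  qed
  show hull: "P = convex hull ?E" using Krein_Milman_Minkowski c by blast
  show fin: "finite ?E" using P(1) finite_polyhedron_extreme_points polytope_imp_polyhedron by blast
  have "aff_dim ?E = 3" using P(2) hull by (metis aff_dim_convex_hull)
  then show "4 \<le> card ?E" using aff_dim_le_card[OF fin] by simp
  show "finite (P \<inter> int_lattice)"
    using finite_int_lattice_bounded[OF compact_imp_bounded[OF c(1)]] by (simp add: Int_commute)
qed

section \<open>The h*-vector in dimension three\<close>

definition h_star_counts :: "(real ^ 3) set \<Rightarrow> nat \<Rightarrow> nat \<Rightarrow> nat \<Rightarrow> bool" where
  "h_star_counts P h1 h2 h3 \<longleftrightarrow>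
     (\<forall>k. card ((*\<^sub>R) (real k) ` P \<inter> int_lattice)
        = ((k + 3) choose 3) + h1 * ((k + 2) choose 3) + h2 * ((k + 1) choose 3) + h3 * (k choose 3))"

lemma h_star_counts_1: "h_star_counts P h1 h2 h3 \<Longrightarrow> card (P \<inter> int_lattice) = h1 + 4"
  unfolding h_star_counts_def by (drule spec[of _ 1]) (simp add: numeral_eq_Suc)

lemma h_star_counts_2: "h_star_counts P h1 h2 h3 \<Longrightarrow> card ((*\<^sub>R) 2 ` P \<inter> int_lattice) = h2 + 4 * h1 + 10"
  unfolding h_star_counts_def by (drule spec[of _ 2]) (simp add: numeral_eq_Suc)

lemma card_lattice_split:
  assumes "P \<in> lattice_polytopes"
  shows "card (P \<inter> int_lattice) = card (frontier P \<inter> int_lattice) + card (interior P \<inter> int_lattice)"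
    and "4 \<le> card (frontier P \<inter> int_lattice)" "finite (frontier P \<inter> int_lattice)"
proof -
  note F = lattice_polytope_facts[OF assms]
  have eq: "P \<inter> int_lattice = (frontier P \<inter> int_lattice) \<union> (interior P \<inter> int_lattice)"
    using compact_imp_closed[OF F(1)] interior_subset[of P] by (auto simp: frontier_def)
  then have fin: "finite (frontier P \<inter> int_lattice)" "finite (interior P \<inter> int_lattice)"
    using F(8) by (metis finite_Un)+
  show "card (P \<inter> int_lattice) = card (frontier P \<inter> int_lattice) + card (interior P \<inter> int_lattice)"
    unfolding eq using fin by (intro card_Un_disjoint) (auto simp: frontier_def)
  show "finite (frontier P \<inter> int_lattice)" by (rule fin)
  then show "4 \<le> card (frontier P \<inter> int_lattice)" using card_mono[OF _ F(4)] F(5) by linarith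
qed

lemma h_star_exists:
  assumes P: "P \<in> lattice_polytopes"
  shows "\<exists>h1 h2 h3. h_star_counts P h1 h2 h3 \<and> h3 = card (interior P \<inter> int_lattice)"
proof -
  note F = lattice_polytope_facts[OF P]
  let ?E = "{v. v extreme_point_of P}"
  let ?V = "lift_point ` ?E"
  have W: "finite ?E" "?E \<subseteq> int_lattice" "aff_dim ?E = 3"
    using F P by (auto simp: lattice_polytopes_def) (metis aff_dim_convex_hull)
  have finV: "finite ?V" using W by simp
  obtain \<omega> where \<omega>: "generic_lift \<omega> ?V" using generic_lift_exists[OF finV] by blast
  obtain w where w: "generic_point w ?V" using generic_point_exists[OF finV] by blast
  obtain c where c: "c \<in> interior P" using F by blast
  have "\<forall>\<^sub>F e in at_right 0. generic_point ((c, 1) + e *\<^sub>R w) ?V \<and> over_interior ((c, 1) + e *\<^sub>R w) P"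
    by (intro eventually_conj eventually_generic_point eventually_over_interior finV w c)
  then obtain q where q: "generic_point q ?V" "over_interior q (convex hull ?E)"
    using eventually_at_right_0_ex F(7) by (metis (no_types, lifting))
  from ehrhart_box_count[OF W \<omega> q] F(7) show ?thesis unfolding h_star_counts_def by metis
qed

text \<open>Coning from an interior lattice point \<open>a\<close>. The generators are \<open>a\<close> and all boundary lattice points,
  so \<open>star_bound\<close> compares the number of boundary lattice points with \<open>h2\<close>. Its two vectors are
  \<open>a \<plusminus> e w\<close> with generic \<open>w\<close>: off \<open>a\<close> their coordinates are those of \<open>\<plusminus> e w\<close>.\<close>

lemma h_star_interior_bound:
  assumes P: "P \<in> lattice_polytopes" and a: "a \<in> interior P" "a \<in> int_lattice"
  shows "\<exists>h1 h2 h3. h_star_counts P h1 h2 h3 \<and> h3 = card (interior P \<inter> int_lattice)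
           \<and> card (frontier P \<inter> int_lattice) \<le> h2 + 3"
proof -
  note F = lattice_polytope_facts[OF P]
  let ?E = "{v. v extreme_point_of P}"
  let ?B = "frontier P \<inter> int_lattice"
  let ?W = "insert a ?B"
  let ?V = "lift_point ` ?W"
  let ?a = "lift_point a"
  have aP: "a \<in> P" using a interior_subset by blast
  have BP: "?B \<subseteq> P" using compact_imp_closed[OF F(1)] frontier_subset_closed by blast
  have finB: "finite ?B" by (rule card_lattice_split[OF P])
  have hull: "convex hull ?W = P"
  proof
    show "convex hull ?W \<subseteq> P" using aP BP F(2) by (intro hull_minimal) auto
    have "?E \<subseteq> ?W" using F(4) by blast
    then show "P \<subseteq> convex hull ?W" using F(7) hull_mono by metis
  qed
  have "aff_dim ?W = aff_dim P" using aff_dim_convex_hull[of ?W] hull by simp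
  then have W: "finite ?W" "?W \<subseteq> int_lattice" "aff_dim ?W = 3"
    using finB a P by (auto simp: lattice_polytopes_def)
  have finV: "finite ?V" using W by simp
  have over_a: "over_interior ?a (convex hull ?W)" using a hull by (simp add: over_interior_def)
  \<comment> \<open>A boundary point in the cone over a basis has no share of the interior point \<open>a\<close>. The squared norm
    is strictly convex, so it lifts such a point strictly below the interpolation over the basis.\<close>
  have conv: "coord T v ?a = 0 \<and> v \<bullet> v < lift_at (\<lambda>u. u \<bullet> u) T v"
    if T: "T \<in> bases_in ?V" and v: "v \<in> ?V - T" "v \<noteq> ?a" "v \<in> nonneg_span T" for T v
  proof
    have b: "basis T" "T \<subseteq> ?V" and fin: "finite T" using T by (auto simp: bases_in_def basis_finite)
    have nn: "0 \<le> coord T v t" if "t \<in> T" for t using v(3) nonneg_span_basis[OF b(1)] that by blast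
    obtain y where y: "v = (y, 1)" "y \<in> frontier P" using v by auto
    show "coord T v ?a = 0"
    proof (rule ccontr)
      assume ne: "coord T v ?a \<noteq> 0"
      then have aT: "?a \<in> T" using real_vector.representation_ne_zero by metis
      have "0 < coord T v ?a" using nn[OF aT] ne by simp
      then have "\<forall>\<^sub>F e in at_right 0. e \<in> {0<..<coord T v ?a}" by (rule eventually_at_right_real)
      then have "\<forall>\<^sub>F e in at_right 0. (y, 1) - e *\<^sub>R ?a \<in> nonneg_span ?V"
      proof eventually_elim
        case (elim e)
        have "0 \<le> coord T v t - e * coord T ?a t" if "t \<in> T" for t
          using elim nn[OF that] by (auto simp: coord_basis[OF b(1) aT])
        then have "v - e *\<^sub>R ?a \<in> nonneg_span T"
          by (simp only: nonneg_span_basis[OF b(1)] mem_Collect_eq coord_diff[OF b(1)] coord_scale[OF b(1)]) blast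
        then show ?case using nonneg_span_mono[OF finV b(2)] y by blast
      qed
      then have "y \<in> interior (convex hull ?W)"
        using retreat_iff_interior[OF W(1) _ over_a] by blast
      then show False using y hull by (simp add: frontier_def)
    qed
    have "snd t = 1" if "t \<in> T" for t using b that by auto
    then have "(\<Sum>t\<in>T. coord T v t) = (\<Sum>t\<in>T. coord T v t * snd t)" by simp
    also have "\<dots> = snd (\<Sum>t\<in>T. coord T v t *\<^sub>R t)" by (simp add: snd_sum)
    also have "\<dots> = 1" using sum_coord[OF b(1), of v] y by simp
    finally have s1: "(\<Sum>t\<in>T. coord T v t) = 1" .
    have "(\<Sum>t\<in>T. coord T v t * (v \<bullet> t)) = v \<bullet> (\<Sum>t\<in>T. coord T v t *\<^sub>R t)"
      by (simp add: inner_sum_right)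
    also have "\<dots> = v \<bullet> v" by (simp add: sum_coord[OF b(1)])
    finally have s2: "(\<Sum>t\<in>T. coord T v t * (v \<bullet> t)) = v \<bullet> v" .
    have "(\<Sum>t\<in>T. coord T v t * ((v - t) \<bullet> (v - t))) =
        (v \<bullet> v) * (\<Sum>t\<in>T. coord T v t) - 2 * (\<Sum>t\<in>T. coord T v t * (v \<bullet> t)) + lift_at (\<lambda>u. u \<bullet> u) T v"
      by (simp add: lift_at_def inner_diff_left inner_diff_right inner_commute algebra_simps
          sum.distrib sum_subtractf sum_distrib_left)
    then have "(\<Sum>t\<in>T. coord T v t * ((v - t) \<bullet> (v - t))) = lift_at (\<lambda>u. u \<bullet> u) T v - v \<bullet> v"
      by (simp add: s1 s2)
    moreover have "0 < (\<Sum>t\<in>T. coord T v t * ((v - t) \<bullet> (v - t)))"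
    proof -
      obtain t where t: "t \<in> T" "coord T v t \<noteq> 0" using s1 by (metis sum.neutral zero_neq_one)
      have "t \<noteq> v" using t v by blast
      then have "0 < coord T v t * ((v - t) \<bullet> (v - t))" using t nn[OF t(1)] by (simp add: inner_gt_zero_iff)
      then show ?thesis using t fin nn by (intro sum_pos2[of T t]) auto
    qed
    ultimately show "v \<bullet> v < lift_at (\<lambda>u. u \<bullet> u) T v" by simp
  qed
  obtain \<omega> where \<omega>: "generic_lift \<omega> ?V"
    and star: "\<forall>T\<in>lower_bases \<omega> ?V. ?a \<in> T \<and> ?V \<inter> nonneg_span T \<subseteq> T"
    using star_lift_exists[OF finV conv] by auto
  obtain w where w: "generic_point w ?V" using generic_point_exists[OF finV] by blast
  have w': "generic_point (- w) ?V" using w by (auto simp: generic_point_def bases_in_def coord_minus)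
  interpret lattice_cone ?V "int_lattice \<times> \<int>" snd \<omega> using lattice_cone_lift[OF W \<omega>] .
  \<comment> \<open>Every cell contains \<open>a\<close>, so \<open>a\<close> is a unit vector in its coordinates.\<close>
  have ca: "coord T (?a + e *\<^sub>R u) t = (if t = ?a then 1 else 0) + e * coord T u t" if "T \<in> cells" for T t e u
    using star that cell_basis[OF that] by (simp add: coord_add coord_scale coord_basis)
  have pos: "\<forall>\<^sub>F e in at_right 0. \<forall>T\<in>cells. 0 < coord T (?a + e *\<^sub>R u) ?a" if u: "generic_point u ?V" for u
    unfolding eventually_ball_finite_distrib[OF finite_cells]
  proof
    fix T assume T: "T \<in> cells"
    have "coord T u ?a \<noteq> 0" using generic_point_cell[OF u T] star T by blast
    then show "\<forall>\<^sub>F e in at_right 0. 0 < coord T (?a + e *\<^sub>R u) ?a"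
      by (rule eventually_mono[OF eventually_sign_affine[of _ 1]]) (simp add: ca[OF T])
  qed
  have good: "\<forall>\<^sub>F e in at_right 0. generic_point (?a + e *\<^sub>R u) ?V \<and> over_interior (?a + e *\<^sub>R u) P
     \<and> (\<forall>T\<in>cells. 0 < coord T (?a + e *\<^sub>R u) ?a)" if u: "generic_point u ?V" for u
    using a by (intro eventually_conj eventually_generic_point eventually_over_interior finV pos u) auto
  obtain e where e: "0 < e"
    "generic_point (?a + e *\<^sub>R w) ?V" "over_interior (?a + e *\<^sub>R w) P" "\<forall>T\<in>cells. 0 < coord T (?a + e *\<^sub>R w) ?a"
    "generic_point (?a + e *\<^sub>R - w) ?V" "over_interior (?a + e *\<^sub>R - w) P" "\<forall>T\<in>cells. 0 < coord T (?a + e *\<^sub>R - w) ?a"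
    using eventually_at_right_0_ex[OF eventually_conj[OF good[OF w] good[OF w']]] by blast
  let ?q = "?a + e *\<^sub>R w" and ?q' = "?a + e *\<^sub>R - w"
  have opp: "\<forall>T\<in>cells. \<forall>t\<in>T - {?a}. coord T ?q t < 0 \<longleftrightarrow> 0 < coord T ?q' t"
  proof (intro ballI)
    fix T t assume T: "T \<in> cells" "t \<in> T - {?a}"
    have "coord T ?q t = e * coord T w t" "coord T ?q' t = - (e * coord T w t)"
      using ca[OF T(1), of e w t] ca[OF T(1), of e "- w" t] T(2) coord_minus[OF cell_basis[OF T(1)], of w t]
      by simp_all
    then show "coord T ?q t < 0 \<longleftrightarrow> 0 < coord T ?q' t" by simp
  qed
  have q'c: "?q' \<in> nonneg_span ?V"
    using over_interior_in_cone[OF W(1)] e(6) hull by auto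
  have "card ?V \<le> box_count ?q (DIM((real ^ 3) \<times> real) - 2) + DIM((real ^ 3) \<times> real)"
    by (rule star_bound[OF e(2,5) q'c _ star _ opp]) (use e in auto)
  moreover have "card ?V = card ?B + 1"
    using finB a by (subst card_image) (auto intro: inj_onI simp: frontier_def)
  ultimately have "card ?B \<le> box_count ?q 2 + 3" by simp
  moreover have "over_interior ?q (convex hull ?W)" using e hull by simp
  note ehrhart_box_count[OF W \<omega> e(2) this]
  ultimately show ?thesis unfolding hull h_star_counts_def by metis
qed

text \<open>The inequality \<open>h1 + 1 \<le> h2 + h3\<close> is Stanley's inequality for the h*-vector in dimension three. It
  and \<open>h3 \<le> h1\<close> are statements about the number of boundary lattice points, which is
  \<open>h1 + 4 - h3\<close>: it is at least four because of the vertices, and at most \<open>h2 + 3\<close> by the previous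
  lemma if there is an interior lattice point.\<close>

theorem h_star_theorem:
  assumes P: "P \<in> lattice_polytopes"
  shows "\<exists>h1 h2 h3. h_star_counts P h1 h2 h3 \<and> h3 = card (interior P \<inter> int_lattice)
           \<and> h3 \<le> h1 \<and> (1 \<le> h3 \<longrightarrow> h1 + 1 \<le> h2 + h3)"
proof (cases "interior P \<inter> int_lattice = {}")
  case True
  then show ?thesis using h_star_exists[OF P] by fastforce
next
  case False
  then obtain a where "a \<in> interior P" "a \<in> int_lattice" by blast
  from h_star_interior_bound[OF P this] obtain h1 h2 h3 where
    h: "h_star_counts P h1 h2 h3" "h3 = card (interior P \<inter> int_lattice)" "card (frontier P \<inter> int_lattice) \<le> h2 + 3"
    by blast
  have "h1 + 4 = card (frontier P \<inter> int_lattice) + h3" "4 \<le> card (frontier P \<inter> int_lattice)"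
    using h_star_counts_1[OF h(1)] card_lattice_split[OF P] h(2) by auto
  then show ?thesis using h by (intro exI[of _ h1] exI[of _ h2] exI[of _ h3]) auto
qed

section \<open>Roots of the cubic\<close>

lemma real_choose_3: "6 * real (n choose 3) = real n * (real n - 1) * (real n - 2)"
proof (induction n)
  case (Suc n)
  have 2: "2 * real (n choose 2) = real n * (real n - 1)"
    by (induction n) (simp_all add: numeral_2_eq_2 algebra_simps)
  have "Suc n choose 3 = (n choose 2) + (n choose 3)" by (simp add: numeral_eq_Suc)
  then have "6 * real (Suc n choose 3) = 3 * (2 * real (n choose 2)) + 6 * real (n choose 3)" by simp
  then show ?case using Suc 2 by (simp add: algebra_simps)
qed simp

text \<open>The binomial coefficients of \<open>h_star_counts\<close> expanded in powers of \<open>k\<close>; the factor \<open>1/6\<close> keeps the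
  coefficients integral combinations of the \<open>h\<close>-numbers.\<close>

definition h_poly :: "nat \<Rightarrow> nat \<Rightarrow> nat \<Rightarrow> real poly" where
  "h_poly h1 h2 h3 = smult (1/6)
     [:6, 11 + 2 * real h1 - real h2 + 2 * real h3, 6 + 3 * real h1 - 3 * real h3, 1 + real h1 + real h2 + real h3:]"

lemma poly_h_poly_nat:
  "poly (h_poly h1 h2 h3) (real k) =
     real (((k + 3) choose 3) + h1 * ((k + 2) choose 3) + h2 * ((k + 1) choose 3) + h3 * (k choose 3))"
proof -
  have "6 * real (((k + 3) choose 3) + h1 * ((k + 2) choose 3) + h2 * ((k + 1) choose 3) + h3 * (k choose 3))
     = (6 * real ((k + 3) choose 3)) + h1 * (6 * real ((k + 2) choose 3)) + h2 * (6 * real ((k + 1) choose 3)) + h3 * (6 * real (k choose 3))"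
    by (simp add: algebra_simps)
  also have "\<dots> = 6 * poly (h_poly h1 h2 h3) (real k)"
    unfolding real_choose_3 by (simp add: h_poly_def algebra_simps)
  finally show ?thesis by simp
qed

lemma poly_eq_on_nat:
  fixes p q :: "real poly"
  assumes "\<And>k::nat. poly p (real k) = poly q (real k)"
  shows "p = q"
proof (rule ccontr)
  assume "p \<noteq> q"
  then have "finite {x. poly (p - q) x = 0}" by (intro poly_roots_finite) simp
  moreover have "range real \<subseteq> {x. poly (p - q) x = 0}" using assms by auto
  ultimately have "finite (range real)" using finite_subset by blast
  then show False using finite_imageD[of real UNIV] by (simp add: inj_def)
qed

lemma ehrhart_poly_h_poly:
  assumes "h_star_counts P h1 h2 h3" shows "ehrhart_poly P = h_poly h1 h2 h3"
proof -
  have *: "\<forall>k. poly (h_poly h1 h2 h3) (real k) = real (card ((*\<^sub>R) (real k) ` P \<inter> int_lattice))"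
    using assms by (simp only: poly_h_poly_nat h_star_counts_def) simp
  then show ?thesis unfolding ehrhart_poly_def
    by (rule the_equality) (use * in \<open>auto intro!: poly_eq_on_nat\<close>)
qed

text \<open>With \<open>v = a\<^sup>2 + b\<^sup>2\<close> and \<open>r = 2 a A + B\<close> these are the coefficient comparisons for
  \<open>A x\<^sup>3 + B x\<^sup>2 + C x + 6 = (x\<^sup>2 - 2 a x + v) (A x + r)\<close>.\<close>

lemma nonreal_root_cubic:
  fixes A B C a b :: real
  assumes root: "of_real A * Complex a b ^ 3 + of_real B * Complex a b ^ 2 + of_real C * Complex a b + 6 = 0"
    and b: "b \<noteq> 0"
  shows "(2 * a * A + B) * (a\<^sup>2 + b\<^sup>2) = 6" "C = A * (a\<^sup>2 + b\<^sup>2) - 2 * a * (2 * a * A + B)"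
proof -
  have "Im (of_real A * Complex a b ^ 3 + of_real B * Complex a b ^ 2 + of_real C * Complex a b + 6) = 0"
    "Re (of_real A * Complex a b ^ 3 + of_real B * Complex a b ^ 2 + of_real C * Complex a b + 6) = 0"
    unfolding root by simp_all
  then have im: "b * (A * (3 * a\<^sup>2 - b\<^sup>2) + 2 * B * a + C) = 0"
    and re: "A * (a ^ 3 - 3 * a * b\<^sup>2) + B * (a\<^sup>2 - b\<^sup>2) + C * a + 6 = 0"
    by (simp_all add: power2_eq_square power3_eq_cube algebra_simps)
  from im b have "A * (3 * a\<^sup>2 - b\<^sup>2) + 2 * B * a + C = 0" by simp
  then have C: "C = A * (b\<^sup>2 - 3 * a\<^sup>2) - 2 * B * a" by (simp add: algebra_simps)
  show "C = A * (a\<^sup>2 + b\<^sup>2) - 2 * a * (2 * a * A + B)"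
    unfolding C by (simp add: power2_eq_square algebra_simps)
  show "(2 * a * A + B) * (a\<^sup>2 + b\<^sup>2) = 6"
    using re unfolding C by (simp add: power2_eq_square power3_eq_cube algebra_simps)
qed

context
  fixes h1 h2 h3 :: nat and A B C :: real
  defines "A \<equiv> 1 + real h1 + real h2 + real h3" and "B \<equiv> 6 + 3 * real h1 - 3 * real h3"
    and "C \<equiv> 11 + 2 * real h1 - real h2 + 2 * real h3"
begin

lemma h_poly_complex:
  "6 * poly (map_poly of_real (h_poly h1 h2 h3)) s = of_real A * s ^ 3 + of_real B * s ^ 2 + of_real C * s + (6 :: complex)"
  by (simp add: h_poly_def A_def B_def C_def map_poly_pCons algebra_simps power2_eq_square power3_eq_cube)

text \<open>In the basis of shifted products every summand has a sign: for \<open>x \<ge> 1\<close> only the product that belongs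
  to \<open>h3\<close> can be negative, and as \<open>h3 \<le> h1\<close> it can be paired with the one that belongs to \<open>h1\<close>. For
  \<open>x < -3\<close> all products are negative.\<close>

lemma real_root_bounds:
  assumes le: "h3 \<le> h1" and root: "A * x ^ 3 + B * x\<^sup>2 + C * x + 6 = (0::real)"
  shows "-3 \<le> x" "x < 1"
proof -
  obtain d where d: "h1 = h3 + d" using le le_Suc_ex by blast
  have eq: "A * x ^ 3 + B * x\<^sup>2 + C * x + 6 = (x + 1) * (x + 2) * (x + 3) + real h3 * (2 * x ^ 3 + 4 * x)
       + real d * (x * (x + 1) * (x + 2)) + real h2 * ((x - 1) * x * (x + 1))"
    by (simp add: A_def B_def C_def d power2_eq_square power3_eq_cube algebra_simps)
  show "x < 1"
  proof (rule ccontr)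
    assume "\<not> ?thesis"
    then have x: "1 \<le> x" by simp
    have "0 < (x + 1) * (x + 2) * (x + 3)" using x by simp
    moreover have "0 \<le> real h3 * (2 * x ^ 3 + 4 * x)" using x by simp
    moreover have "0 \<le> real d * (x * (x + 1) * (x + 2))" using x by simp
    moreover have "0 \<le> real h2 * ((x - 1) * x * (x + 1))" using x by simp
    ultimately show False using root unfolding eq by linarith
  qed
  show "-3 \<le> x"
  proof (rule ccontr)
    assume low: "\<not> ?thesis"
    define y where "y = - x"
    have y: "3 < y" "x = - y" using low by (auto simp: y_def)
    have "0 < (y - 1) * (y - 2) * (y - 3)" using y by simp
    moreover have "0 \<le> real h3 * (2 * y ^ 3 + 4 * y)" using y by simp
    moreover have "0 \<le> real d * (y * (y - 1) * (y - 2))" using y by simp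
    moreover have "0 \<le> real h2 * ((y + 1) * y * (y - 1))" using y by simp
    moreover have "A * x ^ 3 + B * x\<^sup>2 + C * x + 6 = - ((y - 1) * (y - 2) * (y - 3)) - real h3 * (2 * y ^ 3 + 4 * y)
       - real d * (y * (y - 1) * (y - 2)) - real h2 * ((y + 1) * y * (y - 1))"
      unfolding eq unfolding y(2) by (simp add: power3_eq_cube algebra_simps)
    ultimately show False using root by linarith
  qed
qed

text \<open>The quadratic factor is positive on the real line, so the sign of the cubic at a real point is the
  sign of \<open>A x + r\<close>, where \<open>r = 6 / v\<close>. At \<open>-1\<close> the cubic is \<open>- 6 h3\<close>, hence \<open>r \<le> A\<close>, which bounds \<open>a\<close> from
  above. At \<open>-2/A\<close> its sign is that of \<open>r - 2\<close>, and \<open>r \<ge> 2\<close> means \<open>v \<le> 3\<close>. At \<open>-2\<close>, in the case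
  \<open>h3 = 0\<close>, it excludes \<open>h2 = 0\<close>. The lower bound for \<open>a\<close> is \<open>B \<le> 2 A + r\<close>; it follows from Stanley's
  inequality, or from \<open>r = A\<close> and \<open>h2 \<ge> 1\<close> if \<open>h3 = 0\<close>.\<close>

lemma nonreal_root_bounds:
  assumes le: "h3 \<le> h1" and stanley: "1 \<le> h3 \<longrightarrow> h1 + 1 \<le> h2 + h3"
    and root: "of_real A * Complex a b ^ 3 + of_real B * Complex a b ^ 2 + of_real C * Complex a b + 6 = (0 :: complex)"
    and b: "b \<noteq> 0"
  shows "-1 \<le> a" "a < 1" "a\<^sup>2 + b\<^sup>2 \<le> 3"
    and "1 \<le> h3 \<Longrightarrow> a\<^sup>2 + b\<^sup>2 = 3 \<longleftrightarrow> h1 = 1 \<and> h2 = 1 \<and> h3 = 1"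
proof -
  define v where "v = a\<^sup>2 + b\<^sup>2"
  define r where "r = 2 * a * A + B"
  have rv: "r * v = 6" and C: "C = A * v - 2 * a * r"
    using nonreal_root_cubic[OF root b] by (simp_all add: v_def r_def)
  have v: "0 < v" using b by (simp add: v_def sum_power2_gt_zero_iff)
  then have r: "0 < r" using rv by (metis zero_less_mult_pos2 zero_less_numeral)
  have A: "0 < A" by (simp add: A_def)
  have B: "6 \<le> B" using le by (simp add: B_def)
  \<comment> \<open>Both forms of the cubic, evaluated at -1, -2 and (scaled by the square of \<open>A\<close>) at -2/A.\<close>
  have m1: "(1 + 2 * a + v) * (r - A) = - 6 * real h3"
  proof -
    have "(1 + 2 * a + v) * (r - A) = r * v + (r - 2 * a * A) - (A * v - 2 * a * r) - A"
      by (simp add: algebra_simps)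
    also have "\<dots> = 6 + B - C - A" unfolding C[symmetric] rv by (simp add: r_def)
    finally show ?thesis by (simp add: A_def B_def C_def)
  qed
  have pos1: "0 < 1 + 2 * a + v"
  proof -
    have "1 + 2 * a + v = (1 + a)\<^sup>2 + b\<^sup>2" by (simp add: v_def power2_eq_square algebra_simps)
    then show ?thesis using b by (simp add: sum_power2_gt_zero_iff)
  qed
  have m2: "(4 + 4 * a + v) * (r - 2 * A) = - 6 * real h2 - 24 * real h3"
  proof -
    have "(4 + 4 * a + v) * (r - 2 * A) = r * v + 4 * (r - 2 * a * A) - 2 * (A * v - 2 * a * r) - 8 * A"
      by (simp add: algebra_simps)
    also have "\<dots> = 6 + 4 * B - 2 * C - 8 * A" unfolding C[symmetric] rv by (simp add: r_def)
    finally show ?thesis by (simp add: A_def B_def C_def)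
  qed
  have pos2: "0 < 4 + 4 * a + v"
  proof -
    have "4 + 4 * a + v = (2 + a)\<^sup>2 + b\<^sup>2" by (simp add: v_def power2_eq_square algebra_simps)
    then show ?thesis using b by (simp add: sum_power2_gt_zero_iff)
  qed
  have mA: "(4 + 4 * a * A + A\<^sup>2 * v) * (r - 2) = 16 + 12 * (real h1 - real h3) + A * (2 * real h1 + 8 * real h2 + 2 * real h3 - 16)"
  proof -
    have "(4 + 4 * a * A + A\<^sup>2 * v) * (r - 2) = A\<^sup>2 * (r * v) + 4 * (r - 2 * a * A) - 2 * A * (A * v - 2 * a * r) - 8"
      by (simp add: algebra_simps power2_eq_square)
    also have "\<dots> = 6 * A\<^sup>2 + 4 * B - 2 * A * C - 8" unfolding C[symmetric] rv by (simp add: r_def)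
    also have "\<dots> = (4 * B - 8) + A * (6 * A - 2 * C)" by (simp add: power2_eq_square algebra_simps)
    finally show ?thesis by (simp add: B_def C_def) (simp add: A_def algebra_simps)
  qed
  have posA: "0 < 4 + 4 * a * A + A\<^sup>2 * v"
  proof -
    have "4 + 4 * a * A + A\<^sup>2 * v = (2 + a * A)\<^sup>2 + (A * b)\<^sup>2" by (simp add: v_def power2_eq_square algebra_simps)
    then show ?thesis using b A by (simp add: sum_power2_gt_zero_iff)
  qed
  have rA: "r \<le> A"
  proof (rule ccontr)
    assume "\<not> ?thesis"
    then have "0 < (1 + 2 * a + v) * (r - A)" using pos1 by simp
    then show False unfolding m1 by simp
  qed
  have "(2 * a) * A < 2 * A" using rA B A unfolding r_def by linarith
  then show "a < 1" using A by simp
  have low: "-1 \<le> a" if "0 \<le> 2 * A + r - B"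
  proof -
    have "0 \<le> 2 * A * (a + 1)" using that by (simp add: r_def algebra_simps)
    then show ?thesis using A by (simp add: zero_le_mult_iff)
  qed
  have norm: "v \<le> 3" if "2 \<le> r" 
  proof -
    have "2 * v \<le> r * v" using that v by simp
    then show ?thesis using rv by simp
  qed
  have norm3: "v = 3 \<longleftrightarrow> r = 2" using rv by auto
  have "-1 \<le> a \<and> 2 \<le> r \<and> (1 \<le> h3 \<longrightarrow> (r = 2 \<longleftrightarrow> h1 = 1 \<and> h2 = 1 \<and> h3 = 1))"
  proof (cases "h3 = 0")
    case True
    then have rA: "r = A" using m1 pos1 by simp
    then have "(4 + 4 * a + v) * A = 6 * real h2" using m2 True by simp
    then have "0 < h2" using pos2 A by (metis mult_pos_pos of_nat_0 of_nat_0_less_iff zero_less_mult_pos zero_less_numeral)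
    then have "1 \<le> real h2" by simp
    then show ?thesis using low rA True by (simp add: A_def B_def)
  next
    case False
    define Q where "Q = 16 + 12 * (real h1 - real h3) + A * (2 * real h1 + 8 * real h2 + 2 * real h3 - 16)"
    have st: "h1 + 1 \<le> h2 + h3" "1 \<le> h3" "1 \<le> h2" "1 \<le> h1" using stanley False le by auto
    have "0 \<le> 2 * A + r - B" using st r by (simp add: A_def B_def)
    moreover have Q: "0 \<le> Q \<and> (Q = 0 \<longleftrightarrow> h1 = 1 \<and> h2 = 1 \<and> h3 = 1)"
    proof (cases "h2 = 1")
      case True
      define t where "t = real h1 + real h3"
      have "Q = 2 * t * (t - 2) + 12 * (real h1 - real h3)"
        by (simp add: Q_def A_def True t_def algebra_simps)
      moreover have "2 \<le> t" "t = 2 \<longleftrightarrow> h1 = 1 \<and> h3 = 1" using st by (auto simp: t_def)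
      moreover have "0 \<le> 2 * t * (t - 2)" "2 * t * (t - 2) = 0 \<longleftrightarrow> t = 2" using \<open>2 \<le> t\<close> by auto
      moreover have "0 \<le> real h1 - real h3" using le by simp
      moreover have "Q = 0 \<longleftrightarrow> 2 * t * (t - 2) = 0 \<and> 12 * (real h1 - real h3) = 0"
        unfolding calculation(1) using calculation by (intro add_nonneg_eq_0_iff) auto
      ultimately show ?thesis using True by auto
    next
      case False
      then have "0 \<le> 2 * real h1 + 8 * real h2 + 2 * real h3 - 16" using st by simp
      then have "0 \<le> A * (2 * real h1 + 8 * real h2 + 2 * real h3 - 16)" using A by simp
      then show ?thesis using False le by (simp add: Q_def)
    qed
    moreover have "(4 + 4 * a * A + A\<^sup>2 * v) * (r - 2) = Q" using mA by (simp add: Q_def)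
    then have "2 \<le> r" "r = 2 \<longleftrightarrow> Q = 0" using posA Q by (auto simp: zero_le_mult_iff)
    ultimately show ?thesis using low by blast
  qed
  then show "-1 \<le> a" "a\<^sup>2 + b\<^sup>2 \<le> 3" "1 \<le> h3 \<Longrightarrow> a\<^sup>2 + b\<^sup>2 = 3 \<longleftrightarrow> h1 = 1 \<and> h2 = 1 \<and> h3 = 1"
    using norm norm3 by (auto simp: v_def)
qed

lemma root_in_region:
  assumes le: "h3 \<le> h1" and stanley: "1 \<le> h3 \<longrightarrow> h1 + 1 \<le> h2 + h3"
    and root: "of_real A * s ^ 3 + of_real B * s ^ 2 + of_real C * s + 6 = (0 :: complex)"
  shows "s \<in> root_region (-1) 1 3"
proof (cases "s \<in> \<real>")
  case True
  then obtain x where x: "s = of_real x" by (auto elim: Reals_cases)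
  have "of_real (A * x ^ 3 + B * x\<^sup>2 + C * x + 6) = (0 :: complex)" using root x by simp
  then have "A * x ^ 3 + B * x\<^sup>2 + C * x + 6 = 0" by (simp only: of_real_eq_0_iff)
  note bd = real_root_bounds[OF le this]
  show ?thesis
  proof (cases "x \<le> -1")
    case True
    then show ?thesis using bd x by (auto simp: root_region_def)
  next
    case False
    then have "\<bar>x\<bar>\<^sup>2 \<le> 1\<^sup>2" using bd by (intro power_mono) auto
    then have "x\<^sup>2 + 0\<^sup>2 \<le> 3" by simp
    moreover have "s = Complex x 0" by (simp add: x complex_of_real_def)
    ultimately show ?thesis using False bd unfolding root_region_def by force
  qed
next
  case False
  then obtain a b where s: "s = Complex a b" "b \<noteq> 0"
    by (metis complex.exhaust complex_is_Real_iff complex.sel(2))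
  show ?thesis using nonreal_root_bounds[OF le stanley root[unfolded s(1)] s(2)] s
    unfolding root_region_def by blast
qed

end

section \<open>Counting lattice points of explicit simplices\<close>

definition point3 :: "real \<Rightarrow> real \<Rightarrow> real \<Rightarrow> real ^ 3" where
  "point3 a b c = vector [a, b, c]"

lemma point3_nth [simp]: "point3 a b c $ 1 = a" "point3 a b c $ 2 = b" "point3 a b c $ 3 = c"
  by (simp_all add: point3_def)

lemma card_lattice_points:
  "card ({x. Q (x $ 1) (x $ 2) (x $ 3)} \<inter> int_lattice)
     = card {(a, b, c). Q (real_of_int a) (real_of_int b) (real_of_int c)}"
proof -
  let ?f = "\<lambda>(a, b, c). point3 (real_of_int a) (real_of_int b) (real_of_int c)"
  have "bij_betw ?f {(a, b, c). Q (real_of_int a) (real_of_int b) (real_of_int c)}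
     ({x. Q (x $ 1) (x $ 2) (x $ 3)} \<inter> int_lattice)"
    by (rule bij_betw_byWitness[where f' = "\<lambda>x. (\<lfloor>x $ 1\<rfloor>, \<lfloor>x $ 2\<rfloor>, \<lfloor>x $ 3\<rfloor>)"])
      (auto simp: int_lattice_def vec_eq_iff forall_3)
  then show ?thesis by (simp add: bij_betw_same_card)
qed

lemma convex_combination_4:
  assumes "convex S" "p \<in> S" "q \<in> S" "r \<in> S" "s \<in> S"
    and "0 \<le> a" "0 \<le> b" "0 \<le> c" "0 \<le> d" "a + b + c + d = (1 :: real)"
  shows "a *\<^sub>R p + b *\<^sub>R q + c *\<^sub>R r + d *\<^sub>R s \<in> S"
proof -
  have "(\<Sum>i<(4::nat). ([a, b, c, d] ! i) *\<^sub>R ([p, q, r, s] ! i)) \<in> S"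
  proof (rule convex_sum)
    show "(\<Sum>i<(4::nat). [a, b, c, d] ! i) = 1"
      using assms by (simp add: numeral_eq_Suc)
    show "0 \<le> [a, b, c, d] ! i" "[p, q, r, s] ! i \<in> S" if "i \<in> {..<4::nat}" for i
    proof -
      have "i = 0 \<or> i = 1 \<or> i = 2 \<or> i = 3" using that by auto
      then show "0 \<le> [a, b, c, d] ! i" "[p, q, r, s] ! i \<in> S" using assms by auto
    qed
  qed (use assms in auto)
  then show ?thesis by (simp add: numeral_eq_Suc)
qed

lemma convex_linear_ineq: "convex {x :: real ^ 3. e \<le> a * x $ 1 + b * x $ 2 + c * x $ 3}"
proof -
  have "{x :: real ^ 3. e \<le> a * x $ 1 + b * x $ 2 + c * x $ 3} = {x. point3 a b c \<bullet> x \<ge> e}"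
    by (simp add: inner_vec_def sum_3)
  then show ?thesis by (simp only: convex_halfspace_ge)
qed

lemma lattice_simplexI:
  assumes "finite S" "S \<subseteq> int_lattice" "open U" "U \<noteq> {}" "U \<subseteq> convex hull S"
  shows "convex hull S \<in> lattice_polytopes"
proof -
  have "interior (convex hull S) \<noteq> {}" using assms interior_maximal by blast
  then have "aff_dim (convex hull S) = 3" by (simp add: aff_dim_nonempty_interior)
  moreover have "{v. v extreme_point_of convex hull S} \<subseteq> int_lattice"
    using extreme_point_of_convex_hull assms by blast
  ultimately show ?thesis using assms(1) by (simp add: lattice_polytopes_def polytope_def) blast
qed

lemma dilate_Collect:
  assumes "0 < k" shows "(*\<^sub>R) k ` {x :: real ^ 3. Q x} = {x. Q ((1 / k) *\<^sub>R x)}"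
proof (intro equalityI subsetI)
  fix x assume "x \<in> {x. Q ((1 / k) *\<^sub>R x)}"
  then show "x \<in> (*\<^sub>R) k ` {x. Q x}" using assms by (intro image_eqI[of _ _ "(1 / k) *\<^sub>R x"]) auto
qed (use assms in auto)

section \<open>Reeve tetrahedra\<close>

definition reeve :: "nat \<Rightarrow> (real ^ 3) set" where
  "reeve r = convex hull {point3 0 0 0, point3 1 0 0, point3 0 1 0, point3 1 1 (real r)}"

lemma reeve_eq:
  assumes r: "0 < r"
  shows "reeve r = {x. 0 \<le> x $ 3 \<and> x $ 3 \<le> r * x $ 1 \<and> x $ 3 \<le> r * x $ 2 \<and> r * (x $ 1 + x $ 2) \<le> r + x $ 3}"
    (is "_ = ?R")
proof
  have "?R = {x. 0 \<le> 0 * x $ 1 + 0 * x $ 2 + 1 * x $ 3} \<inter> {x. 0 \<le> r * x $ 1 + 0 * x $ 2 + (-1) * x $ 3}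
     \<inter> {x. 0 \<le> 0 * x $ 1 + r * x $ 2 + (-1) * x $ 3} \<inter> {x. - r \<le> (-r) * x $ 1 + (-r) * x $ 2 + 1 * x $ 3}"
    by (auto simp: algebra_simps)
  then have "convex ?R" by (simp only:) (intro convex_Int convex_linear_ineq)
  then show "reeve r \<subseteq> ?R" unfolding reeve_def by (intro hull_minimal) auto
  show "?R \<subseteq> reeve r"
  proof
    fix x assume x: "x \<in> ?R"
    let ?z = "x $ 3 / r"
    have eq: "x = (1 - x $ 1 - x $ 2 + ?z) *\<^sub>R point3 0 0 0 + (x $ 1 - ?z) *\<^sub>R point3 1 0 0
       + (x $ 2 - ?z) *\<^sub>R point3 0 1 0 + ?z *\<^sub>R point3 1 1 (real r)"
      using r by (simp add: vec_eq_iff forall_3)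
    have "0 \<le> 1 - x $ 1 - x $ 2 + ?z" "0 \<le> x $ 1 - ?z" "0 \<le> x $ 2 - ?z" "0 \<le> ?z"
      using x r by (auto simp: field_simps)
    then show "x \<in> reeve r" unfolding reeve_def
      by (subst eq) (intro convex_combination_4 convex_convex_hull hull_inc, auto)
  qed
qed

lemma point3_int [simp]: "point3 a b c \<in> int_lattice \<longleftrightarrow> a \<in> \<int> \<and> b \<in> \<int> \<and> c \<in> \<int>"
  by (simp add: int_lattice_def forall_3)

lemma reeve_lattice_polytope:
  assumes r: "0 < r" shows "reeve r \<in> lattice_polytopes"
  unfolding reeve_def
proof (rule lattice_simplexI)
  let ?U = "{x :: real ^ 3. 0 < x $ 3 \<and> x $ 3 < r * x $ 1 \<and> x $ 3 < r * x $ 2 \<and> r * (x $ 1 + x $ 2) < r + x $ 3}"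
  show "open ?U" by (intro open_Collect_conj open_Collect_less continuous_intros)
  have "point3 (1/2) (1/2) (r/4) \<in> ?U" using r by simp
  then show "?U \<noteq> {}" by blast
  show "?U \<subseteq> convex hull {point3 0 0 0, point3 1 0 0, point3 0 1 0, point3 1 1 (real r)}"
    unfolding reeve_def[symmetric] reeve_eq[OF r] by auto
qed auto

lemma reeve_dilate_card:
  assumes r: "0 < r" and k: "0 < k"
  shows "card ((*\<^sub>R) (real k) ` reeve r \<inter> int_lattice) =
     card {(a :: int, b, c). 0 \<le> c \<and> c \<le> int r * a \<and> c \<le> int r * b \<and> int r * (a + b) \<le> int (k * r) + c}"
proof -
  have "(*\<^sub>R) (real k) ` reeve r = {x. 0 \<le> x $ 3 \<and> x $ 3 \<le> r * x $ 1 \<and> x $ 3 \<le> r * x $ 2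
      \<and> r * (x $ 1 + x $ 2) \<le> real (k * r) + x $ 3}"
  proof -
    have "r * (a / k + b / k) \<le> r + c / k \<longleftrightarrow> r * (a + b) \<le> real (k * r) + c" for a b c :: real
    proof -
      have "r * (a / k + b / k) = (r * (a + b)) / k" "r + c / k = (real (k * r) + c) / k"
        using k by (simp_all add: field_simps)
      then show ?thesis using k by (simp only: divide_le_cancel) simp
    qed
    moreover have "c / k \<le> r * (a / k) \<longleftrightarrow> c \<le> r * a" "0 \<le> c / k \<longleftrightarrow> 0 \<le> c" for a c :: real
      using k by (simp_all add: divide_le_cancel zero_le_divide_iff)
    ultimately show ?thesis
      unfolding reeve_eq[OF r] using k by (subst dilate_Collect) simp_all
  qed
  then have "card ((*\<^sub>R) (real k) ` reeve r \<inter> int_lattice) =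
     card {(a, b, c). 0 \<le> real_of_int c \<and> real_of_int c \<le> r * real_of_int a \<and> real_of_int c \<le> r * real_of_int b
        \<and> r * (real_of_int a + real_of_int b) \<le> real (k * r) + real_of_int c}"
    using card_lattice_points[of "\<lambda>a b c. 0 \<le> c \<and> c \<le> r * a \<and> c \<le> r * b \<and> r * (a + b) \<le> real (k * r) + c"]
    by (simp only:)
  also have "{(a, b, c). 0 \<le> real_of_int c \<and> real_of_int c \<le> r * real_of_int a \<and> real_of_int c \<le> r * real_of_int b
        \<and> r * (real_of_int a + real_of_int b) \<le> real (k * r) + real_of_int c} = 
     {(a :: int, b, c). 0 \<le> c \<and> c \<le> int r * a \<and> c \<le> int r * b \<and> int r * (a + b) \<le> int (k * r) + c}"
  proof -
    have "real_of_int c \<le> r * real_of_int a \<longleftrightarrow> c \<le> int r * a" for a c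
      by (metis of_int_le_iff of_int_mult of_int_of_nat_eq)
    moreover have "r * (real_of_int a + real_of_int b) \<le> real (k * r) + real_of_int c \<longleftrightarrow> int r * (a + b) \<le> int (k * r) + c" for a b c
    proof -
      have "r * (real_of_int a + real_of_int b) = real_of_int (int r * (a + b))"
        "real (k * r) + real_of_int c = real_of_int (int (k * r) + c)" by simp_all
      then show ?thesis by (simp only: of_int_le_iff)
    qed
    ultimately show ?thesis by auto
  qed
  finally show ?thesis .
qed

text \<open>The third coordinate is at most \<open>r\<close> times the smaller one of \<open>a\<close> and \<open>b\<close>, so the last inequality bounds the larger one.\<close>

lemma reeve_base_bounds:
  fixes a b c r k :: int
  assumes "0 < r" "0 \<le> c" "c \<le> r * a" "c \<le> r * b" "r * (a + b) \<le> k * r + c"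
  shows "0 \<le> a" "0 \<le> b" "a \<le> k" "b \<le> k"
proof -
  show "0 \<le> a" "0 \<le> b" using assms by (metis order_trans zero_le_mult_iff not_less order_less_le)+
  have "r * (a + b) = r * a + r * b" "k * r = r * k" by (simp_all add: algebra_simps)
  then have "r * a \<le> r * k" "r * b \<le> r * k" using assms by linarith+
  then show "a \<le> k" "b \<le> k" using assms(1) by simp_all
qed

text \<open>Over every point \<open>(a, b)\<close> of the dilated base the inequalities leave a fibre of lattice points. In the
  second dilate only the fibre over \<open>(1, 1)\<close> has more than one point; this is where \<open>r\<close> enters.\<close>

lemma reeve_h_star:
  assumes r: "0 < r"
  shows "h_star_counts (reeve r) 0 (r - 1) 0"
proof -
  obtain h1 h2 h3 where h: "h_star_counts (reeve r) h1 h2 h3" "h3 \<le> h1"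
    using h_star_theorem[OF reeve_lattice_polytope[OF r]] by blast
  let ?S = "\<lambda>k. {(a :: int, b, c). 0 \<le> c \<and> c \<le> int r * a \<and> c \<le> int r * b \<and> int r * (a + b) \<le> k * int r + c}"
  have "?S 1 = {(0, 0, 0), (1, 0, 0), (0, 1, 0), (1, 1, int r)}"
  proof (intro equalityI subsetI)
    fix x assume "x \<in> ?S 1"
    then obtain a b c where x: "x = (a, b, c)" and S: "0 \<le> c" "c \<le> int r * a" "c \<le> int r * b" "int r * (a + b) \<le> 1 * int r + c" by auto
    have "0 \<le> a" "0 \<le> b" "a \<le> 1" "b \<le> 1" using reeve_base_bounds[OF _ S] r by simp_all
    then have "a = 0 \<or> a = 1" "b = 0 \<or> b = 1" by auto
    then show "x \<in> {(0, 0, 0), (1, 0, 0), (0, 1, 0), (1, 1, int r)}" using S x by auto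
  qed auto
  then have "card (reeve r \<inter> int_lattice) = 4"
    using reeve_dilate_card[OF r, of 1] r by simp
  then have h13: "h1 = 0" "h3 = 0" using h_star_counts_1[OF h(1)] h(2) by auto
  have S2: "?S 2 = {(0, 0, 0), (1, 0, 0), (2, 0, 0), (0, 1, 0), (0, 2, 0), (2, 1, int r), (1, 2, int r), (2, 2, 2 * int r)}
       \<union> {1} \<times> {1} \<times> {0..int r}"
  proof (intro equalityI subsetI)
    fix x assume "x \<in> ?S 2"
    then obtain a b c where x: "x = (a, b, c)" and S: "0 \<le> c" "c \<le> int r * a" "c \<le> int r * b" "int r * (a + b) \<le> 2 * int r + c" by auto
    have "0 \<le> a" "0 \<le> b" "a \<le> 2" "b \<le> 2" using reeve_base_bounds[OF _ S] r by simp_all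
    then have "a = 0 \<or> a = 1 \<or> a = 2" "b = 0 \<or> b = 1 \<or> b = 2" by auto
    then show "x \<in> {(0, 0, 0), (1, 0, 0), (2, 0, 0), (0, 1, 0), (0, 2, 0), (2, 1, int r), (1, 2, int r), (2, 2, 2 * int r)}
       \<union> {1} \<times> {1} \<times> {0..int r}" using S x r by (elim disjE) simp_all
  qed auto
  have "card (?S 2) = 8 + card {0..int r}"
    unfolding S2 by (subst card_Un_disjoint) auto
  then have "card ((*\<^sub>R) 2 ` reeve r \<inter> int_lattice) = 9 + r"
    using reeve_dilate_card[OF r, of 2] by simp
  then have "h2 = r - 1" using h_star_counts_2[OF h(1)] h13 by simp
  then show ?thesis using h(1) h13 by simp
qed

section \<open>The simplex \<open>S\<^sub>3(1)\<close>\<close>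

lemma S3_1_point3: "S3_1 = convex hull {point3 1 0 0, point3 0 1 0, point3 0 0 1, point3 (-1) (-1) (-1)}"
proof -
  have "axis 1 1 = point3 1 0 0" "axis 2 1 = point3 0 1 0" "axis 3 1 = point3 0 0 1"
    by (simp_all add: vec_eq_iff forall_3 axis_def)
  moreover have "- (point3 1 0 0 + point3 0 1 0 + point3 0 0 1) = point3 (-1) (-1) (-1)"
    by (simp add: vec_eq_iff forall_3)
  ultimately show ?thesis by (simp add: S3_1_def)
qed

lemma S3_1_eq:
  "S3_1 = {x. x $ 1 + x $ 2 + x $ 3 \<le> 1 \<and> x $ 2 + x $ 3 \<le> 3 * x $ 1 + 1 \<and> x $ 1 + x $ 3 \<le> 3 * x $ 2 + 1
             \<and> x $ 1 + x $ 2 \<le> 3 * x $ 3 + 1}"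
    (is "_ = ?R")
proof
  have "?R = {x. -1 \<le> (-1) * x $ 1 + (-1) * x $ 2 + (-1) * x $ 3} \<inter> {x. -1 \<le> 3 * x $ 1 + (-1) * x $ 2 + (-1) * x $ 3}
     \<inter> {x. -1 \<le> (-1) * x $ 1 + 3 * x $ 2 + (-1) * x $ 3} \<inter> {x. -1 \<le> (-1) * x $ 1 + (-1) * x $ 2 + 3 * x $ 3}"
    by auto
  then have "convex ?R" by (simp only:) (intro convex_Int convex_linear_ineq)
  then show "S3_1 \<subseteq> ?R" unfolding S3_1_point3 by (intro hull_minimal) auto
  show "?R \<subseteq> S3_1"
  proof
    fix x assume x: "x \<in> ?R"
    let ?z = "(1 - x $ 1 - x $ 2 - x $ 3) / 4"
    have eq: "x = (x $ 1 + ?z) *\<^sub>R point3 1 0 0 + (x $ 2 + ?z) *\<^sub>R point3 0 1 0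
       + (x $ 3 + ?z) *\<^sub>R point3 0 0 1 + ?z *\<^sub>R point3 (-1) (-1) (-1)"
      by (simp add: vec_eq_iff forall_3 field_simps)
    have "0 \<le> x $ 1 + ?z" "0 \<le> x $ 2 + ?z" "0 \<le> x $ 3 + ?z" "0 \<le> ?z"
      "x $ 1 + ?z + (x $ 2 + ?z) + (x $ 3 + ?z) + ?z = 1"
      using x by (auto simp: field_simps)
    then show "x \<in> S3_1" unfolding S3_1_point3
      by (subst eq) (intro convex_combination_4 convex_convex_hull hull_inc, auto)
  qed
qed

lemma S3_1_facts: "S3_1 \<in> lattice_polytopes" "0 \<in> interior S3_1"
proof -
  let ?U = "{x :: real ^ 3. x $ 1 + x $ 2 + x $ 3 < 1 \<and> x $ 2 + x $ 3 < 3 * x $ 1 + 1 \<and> x $ 1 + x $ 3 < 3 * x $ 2 + 1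
             \<and> x $ 1 + x $ 2 < 3 * x $ 3 + 1}"
  have U: "open ?U" by (intro open_Collect_conj open_Collect_less continuous_intros)
  have 0: "0 \<in> ?U" by simp
  have sub: "?U \<subseteq> S3_1" unfolding S3_1_eq by auto
  show "0 \<in> interior S3_1" using interior_maximal[OF sub U] 0 by blast
  show "S3_1 \<in> lattice_polytopes" unfolding S3_1_point3
  proof (rule lattice_simplexI[OF _ _ U])
    show "?U \<noteq> {}" using 0 by blast
    show "?U \<subseteq> convex hull {point3 1 0 0, point3 0 1 0, point3 0 0 1, point3 (-1) (-1) (-1)}"
      using sub unfolding S3_1_point3 .
  qed auto
qed

lemma S3_1_dilate_card:
  assumes k: "0 < k"
  shows "card ((*\<^sub>R) (real k) ` S3_1 \<inter> int_lattice) =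
     card {(a :: int, b, c). a + b + c \<le> int k \<and> b + c \<le> 3 * a + int k \<and> a + c \<le> 3 * b + int k \<and> a + b \<le> 3 * c + int k}"
proof -
  have "(*\<^sub>R) (real k) ` S3_1 = {x. x $ 1 + x $ 2 + x $ 3 \<le> real k \<and> x $ 2 + x $ 3 \<le> 3 * x $ 1 + real k
       \<and> x $ 1 + x $ 3 \<le> 3 * x $ 2 + real k \<and> x $ 1 + x $ 2 \<le> 3 * x $ 3 + real k}"
  proof -
    have "a / k + b / k \<le> 3 * (c / k) + 1 \<longleftrightarrow> a + b \<le> 3 * c + real k" for a b c :: real
    proof -
      have "a / k + b / k = (a + b) / k" "3 * (c / k) + 1 = (3 * c + real k) / k"
        using k by (simp_all add: field_simps)
      then show ?thesis using k by (simp only: divide_le_cancel) simp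
    qed
    moreover have "a / k + b / k + c / k \<le> 1 \<longleftrightarrow> a + b + c \<le> real k" for a b c :: real
      using k by (simp add: field_simps)
    ultimately show ?thesis
      unfolding S3_1_eq using k by (subst dilate_Collect) simp_all
  qed
  then have "card ((*\<^sub>R) (real k) ` S3_1 \<inter> int_lattice) = card {(a, b, c). 
       real_of_int a + real_of_int b + real_of_int c \<le> real k \<and> real_of_int b + real_of_int c \<le> 3 * real_of_int a + real k
       \<and> real_of_int a + real_of_int c \<le> 3 * real_of_int b + real k \<and> real_of_int a + real_of_int b \<le> 3 * real_of_int c + real k}"
    using card_lattice_points[of "\<lambda>a b c. a + b + c \<le> real k \<and> b + c \<le> 3 * a + real k \<and> a + c \<le> 3 * b + real k
      \<and> a + b \<le> 3 * c + real k"]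
    by (simp only:)
  also have "{(a, b, c). 
       real_of_int a + real_of_int b + real_of_int c \<le> real k \<and> real_of_int b + real_of_int c \<le> 3 * real_of_int a + real k
       \<and> real_of_int a + real_of_int c \<le> 3 * real_of_int b + real k \<and> real_of_int a + real_of_int b \<le> 3 * real_of_int c + real k}
    = {(a :: int, b, c). a + b + c \<le> int k \<and> b + c \<le> 3 * a + int k \<and> a + c \<le> 3 * b + int k \<and> a + b \<le> 3 * c + int k}"
    by auto
  finally show ?thesis .
qed

text \<open>The first two dilates have 5 and 15 lattice points; the third entry is at least one because of the
  interior point 0 and at most \<open>h1\<close>.\<close>

lemma S3_1_h_star: "h_star_counts S3_1 1 1 1"
proof -
  obtain h1 h2 h3 where h: "h_star_counts S3_1 h1 h2 h3" "h3 = card (interior S3_1 \<inter> int_lattice)" "h3 \<le> h1"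
    using h_star_theorem[OF S3_1_facts(1)] by blast
  let ?S = "\<lambda>k. {(a :: int, b, c). a + b + c \<le> k \<and> b + c \<le> 3 * a + k \<and> a + c \<le> 3 * b + k \<and> a + b \<le> 3 * c + k}"
  let ?F = "\<lambda>n k. filter (\<lambda>(a, b, c). a + b + c \<le> k \<and> b + c \<le> 3 * a + k \<and> a + c \<le> 3 * b + k \<and> a + b \<le> 3 * c + k)
     (List.product [-n..n] (List.product [-n..n] [-n..n]))"
  \<comment> \<open>Weighted averages of the four inequalities bound every coordinate by \<open>k\<close> in absolute value.\<close>
  have S: "?S k = set (?F k k)" for k
    by auto
  have d: "distinct (?F k k)" for k :: int by (intro distinct_filter distinct_product distinct_upto)
  have "card (?S 1) = length (?F 1 1)" unfolding S using distinct_card[OF d] .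
  also have "\<dots> = 5" by code_simp
  finally have "card (S3_1 \<inter> int_lattice) = 5" using S3_1_dilate_card[of 1] by simp
  then have h1: "h1 = 1" using h_star_counts_1[OF h(1)] by simp
  have "card (?S 2) = length (?F 2 2)" unfolding S using distinct_card[OF d] .
  also have "\<dots> = 15" by code_simp
  finally have "card ((*\<^sub>R) 2 ` S3_1 \<inter> int_lattice) = 15" using S3_1_dilate_card[of 2] by simp
  then have h2: "h2 = 1" using h_star_counts_2[OF h(1)] h1 by simp
  have "0 \<in> interior S3_1 \<inter> int_lattice" using S3_1_facts by (simp add: int_lattice_def)
  moreover have "finite (interior S3_1 \<inter> int_lattice)"
    using lattice_polytope_facts(8)[OF S3_1_facts(1)] interior_subset by (metis Int_mono finite_subset order_refl)
  ultimately have "h3 \<noteq> 0" using h(2) by (metis card_0_eq empty_iff)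
  then have "h3 = 1" using h(3) h1 by simp
  then show ?thesis using h(1) h1 h2 by simp
qed

section \<open>Location of the roots\<close>

lemma ehrhart_root_iff:
  assumes "h_star_counts P h1 h2 h3"
  shows "ehrhart_fun s P = 0 \<longleftrightarrow>
     of_real (1 + real h1 + real h2 + real h3) * s ^ 3 + of_real (6 + 3 * real h1 - 3 * real h3) * s ^ 2
     + of_real (11 + 2 * real h1 - real h2 + 2 * real h3) * s + 6 = 0"
  using h_poly_complex[of h1 h2 h3 s] unfolding ehrhart_fun_def ehrhart_poly_h_poly[OF assms]
  by (metis mult_eq_0_iff zero_neq_numeral)

lemma reeve_2_root: "ehrhart_fun (Complex (-1) (sqrt 2)) (reeve 2) = 0"
  using reeve_h_star[of 2]
  by (subst ehrhart_root_iff) (auto simp: complex_eq_iff power3_eq_cube power2_eq_square)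

text \<open>For \<open>h2 = N\<close> the quadratic factor at \<open>x0\<close> is \<open>- N (x0 - x0\<^sup>2)\<close> up to a term less than 12, so it is
  negative for large \<open>N\<close>, while it is positive at 1.\<close>

lemma reeve_real_root:
  fixes x0 :: real
  assumes "0 < x0" "x0 < 1"
  shows "\<exists>r>0. \<exists>x. x0 \<le> x \<and> ehrhart_fun (of_real x) (reeve r) = 0"
proof -
  obtain N :: nat where N: "12 / (x0 - x0\<^sup>2) < real N" using reals_Archimedean2 by blast
  define f where "f x = (1 + real N) * x\<^sup>2 + (5 - real N) * x + 6" for x :: real
  have "0 < x0 * (1 - x0)" using assms by simp
  then have d: "0 < x0 - x0\<^sup>2" by (simp add: power2_eq_square algebra_simps)
  then have "12 < real N * (x0 - x0\<^sup>2)" using N by (simp add: field_simps)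
  moreover have "x0\<^sup>2 < 1" using assms by (simp add: power_less_one_iff)
  moreover have "f x0 = - (real N * (x0 - x0\<^sup>2)) + x0\<^sup>2 + 5 * x0 + 6" by (simp add: f_def algebra_simps)
  ultimately have "f x0 \<le> 0" using assms by linarith
  moreover have "0 \<le> f 1" by (simp add: f_def)
  moreover have "continuous_on {x0..1} f" unfolding f_def by (intro continuous_intros)
  ultimately obtain x where x: "x0 \<le> x" "f x = 0" using IVT'[of f x0 0 1] assms by auto
  have "(1 + real N) * x ^ 3 + 6 * x\<^sup>2 + (11 - real N) * x + 6 = (x + 1) * f x"
    by (simp add: f_def power2_eq_square power3_eq_cube algebra_simps)
  then have "complex_of_real ((1 + real N) * x ^ 3 + 6 * x\<^sup>2 + (11 - real N) * x + 6) = 0" using x by simp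
  moreover have "h_star_counts (reeve (Suc N)) 0 N 0" using reeve_h_star[of "Suc N"] by simp
  ultimately have "ehrhart_fun (of_real x) (reeve (Suc N)) = 0"
    by (subst ehrhart_root_iff) auto
  then show ?thesis using x(1) by blast
qed

lemma S3_1_root: "ehrhart_fun (Complex (-1/2) (sqrt 11 / 2)) S3_1 = 0"
  using S3_1_h_star
  by (subst ehrhart_root_iff) (auto simp: complex_eq_iff power3_eq_cube power2_eq_square field_simps)

lemma norm_eq_sqrt_3_iff: "cmod (Complex a b) = sqrt 3 \<longleftrightarrow> a\<^sup>2 + b\<^sup>2 = 3"
  by (simp add: cmod_def)

lemma nonreal_obtain:
  assumes "s \<notin> \<real>" obtains a b where "s = Complex a b" "b \<noteq> 0"
  using assms by (metis complex.exhaust complex_is_Real_iff complex.sel(2))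

theorem theorem1p10:
  shows "(\<forall>P \<in> lattice_polytopes. {s. ehrhart_fun s P = 0} \<subseteq> root_region (-1) 1 3)
    \<and> (\<forall>\<alpha> \<beta> \<rho>. (\<forall>P \<in> lattice_polytopes. {s. ehrhart_fun s P = 0} \<subseteq> root_region \<alpha> \<beta> \<rho>)
          \<longrightarrow> \<alpha> \<le> -1 \<and> 1 \<le> \<beta> \<and> 3 \<le> \<rho>)
    \<and> (\<exists>s. ehrhart_fun s S3_1 = 0 \<and> s \<notin> \<real>)
    \<and> (\<forall>s. ehrhart_fun s S3_1 = 0 \<and> s \<notin> \<real> \<longrightarrow> cmod s = sqrt 3)
    \<and> (\<forall>l \<ge> 1. \<forall>P \<in> lattice_polytopes_int l.
          (\<exists>s. ehrhart_fun s P = 0 \<and> s \<notin> \<real> \<and> cmod s = sqrt 3)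
          \<longrightarrow> (\<forall>s. ehrhart_fun s P = ehrhart_fun s S3_1))"
proof (intro conjI)
  show "\<forall>P \<in> lattice_polytopes. {s. ehrhart_fun s P = 0} \<subseteq> root_region (-1) 1 3"
  proof (intro ballI subsetI)
    fix P s assume P: "P \<in> lattice_polytopes" and "s \<in> {s. ehrhart_fun s P = 0}"
    then have root: "ehrhart_fun s P = 0" by simp
    obtain h1 h2 h3 where h: "h_star_counts P h1 h2 h3" "h3 \<le> h1" "1 \<le> h3 \<longrightarrow> h1 + 1 \<le> h2 + h3"
      using h_star_theorem[OF P] by blast
    show "s \<in> root_region (-1) 1 3"
      using root_in_region[OF h(2,3)] root unfolding ehrhart_root_iff[OF h(1)] by blast
  qed
  show "\<forall>\<alpha> \<beta> \<rho>. (\<forall>P \<in> lattice_polytopes. {s. ehrhart_fun s P = 0} \<subseteq> root_region \<alpha> \<beta> \<rho>)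
          \<longrightarrow> \<alpha> \<le> -1 \<and> 1 \<le> \<beta> \<and> 3 \<le> \<rho>"
  proof (intro allI impI)
    fix \<alpha> \<beta> \<rho>
    assume "\<forall>P \<in> lattice_polytopes. {s. ehrhart_fun s P = 0} \<subseteq> root_region \<alpha> \<beta> \<rho>"
    then have sub: "s \<in> root_region \<alpha> \<beta> \<rho>" if "0 < r" "ehrhart_fun s (reeve r) = 0" for r s
      using that reeve_lattice_polytope by blast
    have "Complex (-1) (sqrt 2) \<in> root_region \<alpha> \<beta> \<rho>" using sub[OF _ reeve_2_root] by simp
    then have "\<alpha> \<le> -1 \<and> 3 \<le> \<rho>" by (auto simp: root_region_def complex_eq_iff)
    moreover have "1 \<le> \<beta>"
    proof (rule ccontr)
      assume "\<not> 1 \<le> \<beta>"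
      then have "0 < max \<beta> (1/2)" "max \<beta> (1/2) < 1" by auto
      then obtain r x where r: "0 < r" "max \<beta> (1/2) \<le> x" "ehrhart_fun (of_real x) (reeve r) = 0"
        using reeve_real_root by blast
      then have "complex_of_real x \<in> root_region \<alpha> \<beta> \<rho>" using sub by blast
      then show False using r(2) by (auto simp: root_region_def complex_eq_iff)
    qed
    ultimately show "\<alpha> \<le> -1 \<and> 1 \<le> \<beta> \<and> 3 \<le> \<rho>" by blast
  qed
  show "\<exists>s. ehrhart_fun s S3_1 = 0 \<and> s \<notin> \<real>"
    using S3_1_root by (intro exI[of _ "Complex (-1/2) (sqrt 11 / 2)"]) (simp add: complex_is_Real_iff)
  show "\<forall>s. ehrhart_fun s S3_1 = 0 \<and> s \<notin> \<real> \<longrightarrow> cmod s = sqrt 3"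
  proof (intro allI impI)
    fix s assume s: "ehrhart_fun s S3_1 = 0 \<and> s \<notin> \<real>"
    obtain a b where ab: "s = Complex a b" "b \<noteq> 0" using nonreal_obtain s by blast
    have "a\<^sup>2 + b\<^sup>2 = 3"
      using nonreal_root_bounds(4)[of 1 1 1 a b] s ab ehrhart_root_iff[OF S3_1_h_star, of s] by simp
    then show "cmod s = sqrt 3" using ab norm_eq_sqrt_3_iff by simp
  qed
  show "\<forall>l \<ge> 1. \<forall>P \<in> lattice_polytopes_int l. (\<exists>s. ehrhart_fun s P = 0 \<and> s \<notin> \<real> \<and> cmod s = sqrt 3)
          \<longrightarrow> (\<forall>s. ehrhart_fun s P = ehrhart_fun s S3_1)"
  proof (intro allI impI ballI)
    fix l :: nat and P s'
    assume l: "1 \<le> l" "P \<in> lattice_polytopes_int l" and "\<exists>s. ehrhart_fun s P = 0 \<and> s \<notin> \<real> \<and> cmod s = sqrt 3"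
    then obtain s where s: "ehrhart_fun s P = 0" "s \<notin> \<real>" "cmod s = sqrt 3" by blast
    have P: "P \<in> lattice_polytopes" "card (interior P \<inter> int_lattice) = l"
      using l by (auto simp: lattice_polytopes_int_def)
    obtain h1 h2 h3 where h: "h_star_counts P h1 h2 h3" "h3 \<le> h1" "1 \<le> h3 \<longrightarrow> h1 + 1 \<le> h2 + h3" "h3 = l"
      using h_star_theorem[OF P(1)] P(2) by blast
    obtain a b where ab: "s = Complex a b" "b \<noteq> 0" using nonreal_obtain s by blast
    have "a\<^sup>2 + b\<^sup>2 = 3" using s(3) ab norm_eq_sqrt_3_iff by simp
    then have "h1 = 1 \<and> h2 = 1 \<and> h3 = 1"
      using nonreal_root_bounds(4)[OF h(2,3) _ ab(2)] s(1) h(4) l(1)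
      unfolding ehrhart_root_iff[OF h(1)] ab(1) by blast
    then have "ehrhart_poly P = ehrhart_poly S3_1"
      using ehrhart_poly_h_poly[OF h(1)] ehrhart_poly_h_poly[OF S3_1_h_star] by simp
    then show "ehrhart_fun s' P = ehrhart_fun s' S3_1" by (simp add: ehrhart_fun_def)
  qed
qed

end
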